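(* Fix a real number $q$ with $0<q<\frac12$. For each integer $n\ge 1$, consider the two-phase game with parameters $(q,n)$ described in the context, and let $V_n(q)$ be the conditional variance of the duration of Phase II given that team B wins. Then, as $n\to\infty$, $$V_n(q)\to\frac{(1-q)(2+3q-4q^2)}{(1-2q)^4}.$$ More precisely, as $n\to\infty$, $$V_n(q)=\frac{(q-1)(4q^2-3q-2)}{(2q-1)^4}-\frac{(q-1)(4q^2+2q-7)}{(2q-1)^6}\cdot\frac1n-\frac{(q-1)(24q^4-12q^3-58q^2+29q+18)}{(2q-1)^8}\cdot\frac1{n^2}$$ $$-\frac{(q-1)(144q^6-216q^5-348q^4+444q^3+328q^2-312q-41)}{(2q-1)^{10}}\cdot\frac1{n^3}$$ $$-\frac{(q-1)(864q^8-2160q^7-1704q^6+4956q^5+4632q^4-9972q^3+1586q^2+1711q+88)}{(2q-1)^{12}}\cdot\frac1{n^4}+O\!\left(\frac1{n^5}\right).$$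
   Context: The two-phase game with parameters $q\in(0,\frac12)$ and positive integer $n$: two teams, G and B, play; each successive goal is scored by B with probability $q$ and by G with probability $1-q$, independently of all other goals. Phase I: play until G has scored $n$ goals; let $m$ be the number of goals B has scored by then. Phase II: if $m\ge n$, team B is declared the winner immediately (Phase II has duration $0$). If $m<n$, they keep playing until B has caught up and tied the score, in which case B is declared the winner; if B never ties the score, B loses. The duration of Phase II is the number of goals scored (by either team) during Phase II. The conditional variance given that B wins is the variance of this duration under the conditional probability measure given the event that B wins. The implied constant in $O(\cdot)$ may depend on the fixed $q$. *)

theory Defs
  imports "HOL-Probability.Probability"
begin

text \<open>
  The sample space is the space of infinite sequences of goals: \<open>\<omega> !! i\<close> is \<open>True\<close> iff goal number
  \<open>i\<close> (counting from 0) is scored by team B. Only finitely many of these goals are relevant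
  to the game if it ends; the sequence simply goes on after the end of the game.
\<close>

definition goals_space :: "real \<Rightarrow> bool stream measure" where
  "goals_space q = stream_space (measure_pmf (bernoulli_pmf q))"

definition goals_B :: "bool stream \<Rightarrow> nat \<Rightarrow> nat" where
  "goals_B \<omega> k = card {i. i < k \<and> \<omega> !! i}"

definition goals_G :: "bool stream \<Rightarrow> nat \<Rightarrow> nat" where
  "goals_G \<omega> k = card {i. i < k \<and> \<not> \<omega> !! i}"

definition phase1_ends :: "nat \<Rightarrow> bool stream \<Rightarrow> bool" where
  "phase1_ends n \<omega> \<longleftrightarrow> (\<exists>k. goals_G \<omega> k = n)"

text \<open>
  The \<open>LEAST\<close> below is meaningful only if \<open>phase1_ends n \<omega>\<close>, which holds almost surely
  for \<open>q < 1\<close>.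
\<close>

definition phase1_length :: "nat \<Rightarrow> bool stream \<Rightarrow> nat" where
  "phase1_length n \<omega> = (LEAST k. goals_G \<omega> k = n)"

definition phase1_B :: "nat \<Rightarrow> bool stream \<Rightarrow> nat" where
  "phase1_B n \<omega> = goals_B \<omega> (phase1_length n \<omega>)"

definition tied_after :: "nat \<Rightarrow> bool stream \<Rightarrow> nat \<Rightarrow> bool" where
  "tied_after n \<omega> d \<longleftrightarrow>
     goals_B \<omega> (phase1_length n \<omega> + d) = goals_G \<omega> (phase1_length n \<omega> + d)"

definition B_wins :: "nat \<Rightarrow> bool stream \<Rightarrow> bool" where
  "B_wins n \<omega> \<longleftrightarrow> phase1_ends n \<omega> \<and> (phase1_B n \<omega> \<ge> n \<or> (\<exists>d. tied_after n \<omega> d))"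

text \<open>
  If B never ties the score then Phase II does not end and the value below is irrelevant: the
  duration is only ever used conditionally on \<open>B_wins\<close>, where the \<open>LEAST\<close> is attained.
\<close>

definition phase2_duration :: "nat \<Rightarrow> bool stream \<Rightarrow> nat" where
  "phase2_duration n \<omega> = (if phase1_B n \<omega> \<ge> n then 0 else (LEAST d. tied_after n \<omega> d))"

text \<open>
  \<open>uniform_measure M A\<close> is the conditional probability measure
  \<open>B \<mapsto> emeasure M (A \<inter> B) / emeasure M A\<close>.
\<close>

definition given_B_wins :: "real \<Rightarrow> nat \<Rightarrow> bool stream measure" where
  "given_B_wins q n =
     uniform_measure (goals_space q) {\<omega> \<in> space (goals_space q). B_wins n \<omega>}"

definition phase2_variance :: "real \<Rightarrow> nat \<Rightarrow> real" where
  "phase2_variance q n =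
     prob_space.variance (given_B_wins q n) (\<lambda>\<omega>. real (phase2_duration n \<omega>))"

end

theory Submission
  imports Defs "HOL-Computational_Algebra.Polynomial" "HOL-Library.Landau_Symbols"
begin

text \<open>
  Write \<open>\<delta> = 1 - 2 q\<close>. B wins in Phase I with the same probability as by catching up later. From a
  deficit \<open>s\<close>, catching up has probability \<open>(q / (1 - q)) ^ s\<close>, and given that it happens the time it
  takes is the first passage time of the walk with \<open>q\<close> and \<open>1 - q\<close> exchanged, whose mean and
  variance are \<open>s / \<delta>\<close> and \<open>4 q (1 - q) s / \<delta>\<^sup>3\<close>. So the conditional variance is determined by
  the first two moments of the tilted deficit. Up to normalization these are truncated binomial sums,
  and the ratio recursion of the binomial coefficients expresses both through the single ratio
  \<open>R n = T n / (\<delta> a n)\<close> of the sum \<open>T n\<close> of the weights to the boundary weight \<open>a n\<close>.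

  As \<open>T n = T (n + 1) + \<delta> a n\<close>, the ratio satisfies \<open>R n = 1 + t n * R (n + 1)\<close> with
  \<open>t n \<le> 1 - \<delta>\<^sup>2\<close>. This recursion contracts when run from infinity, so every bounded approximate
  solution with residual \<open>O(1 / n ^ 7)\<close> agrees with \<open>R\<close> up to \<open>O(1 / n ^ 7)\<close>. The variance is
  quadratic in \<open>1 / R n\<close> with coefficients of order \<open>n\<^sup>2\<close>, which leaves the error \<open>O(1 / n ^ 5)\<close>.
\<close>

section \<open>First passage moments\<close>

text \<open>First-step recursion for the probability that a deficit \<open>s\<close> is made up for
  the first time after exactly \<open>d\<close> goals; deficit 0 is absorbing. It is tied to the
  sample space only in \<open>prob_catches_up\<close>.\<close>

fun first_passage :: "real \<Rightarrow> nat \<Rightarrow> nat \<Rightarrow> real" where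
  "first_passage q s 0 = (if s = 0 then 1 else 0)"
| "first_passage q 0 (Suc d) = 0"
| "first_passage q (Suc s) (Suc d) =
     q * first_passage q s d + (1 - q) * first_passage q (s + 2) d"

lemma first_passage_nonneg: "0 \<le> q \<Longrightarrow> q \<le> 1 \<Longrightarrow> 0 \<le> first_passage q s d"
  by (induction q s d rule: first_passage.induct) auto

text \<open>Successive increments of a harmonic function have the fixed ratio
  \<open>r = q / (1 - q)\<close>, so \<open>e s\<close> is \<open>e 1\<close> times a geometric sum
  that starts with 1. Such a sequence can vanish at infinity only if \<open>e 1 = 0\<close>.\<close>

lemma walk_harmonic_unique:
  fixes e :: "nat \<Rightarrow> real"
  assumes q: "0 \<le> q" "q < 1" and e0: "e 0 = 0"
    and rec: "\<And>s. e (Suc s) = q * e s + (1 - q) * e (s + 2)"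
    and lim: "e \<longlonglongrightarrow> 0"
  shows "e s = 0"
proof -
  define r where "r = q / (1 - q)"
  have r: "r \<ge> 0" using q by (simp add: r_def)
  have step: "e (Suc s) - e s = e 1 * r ^ s" for s
  proof (induction s)
    case (Suc s)
    have "(1 - q) * (e (Suc (Suc s)) - e (Suc s)) = q * (e (Suc s) - e s)"
      using rec[of s] by (simp add: algebra_simps)
    then have "e (Suc (Suc s)) - e (Suc s) = r * (e (Suc s) - e s)"
      using q by (simp add: r_def field_simps)
    then show ?case using Suc by simp
  qed (use e0 in simp)
  have form: "e s = e 1 * (\<Sum>i<s. r ^ i)" for s
  proof (induction s)
    case (Suc s)
    then show ?case using step[of s] by (simp add: algebra_simps)
  qed (use e0 in simp)
  have "\<bar>e 1\<bar> \<le> \<bar>e (Suc s)\<bar>" for s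
  proof -
    have "(\<Sum>i<Suc s. r ^ i) \<ge> 1"
      using r by (subst sum.lessThan_Suc_shift) (simp add: sum_nonneg)
    then show ?thesis
      by (subst form[of "Suc s"]) (simp add: abs_mult mult_le_cancel_left1 del: sum.lessThan_Suc)
  qed
  moreover have "(\<lambda>s. \<bar>e (Suc s)\<bar>) \<longlonglongrightarrow> 0"
    using lim LIMSEQ_Suc tendsto_rabs_zero by blast
  ultimately have "\<bar>e 1\<bar> \<le> 0"
    by (intro LIMSEQ_le_const[of "\<lambda>s. \<bar>e (Suc s)\<bar>"]) auto
  then show ?thesis using form[of s] by simp
qed

text \<open>
  The solution \<open>\<phi>\<close> bounds the partial sums, hence the limit; the difference of \<open>\<phi>\<close> and the limit is
  harmonic, zero at \<open>0\<close> and vanishes at infinity.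
\<close>

lemma walk_sums:
  fixes F b :: "nat \<Rightarrow> nat \<Rightarrow> real"
  assumes q: "0 < q" "q < 1"
    and nonneg: "\<And>s d. 0 \<le> F s d" "\<And>s d. 0 \<le> b s d" "\<And>s. 0 \<le> \<phi> s"
    and F0: "F 0 0 = \<phi> 0" "\<And>d. F 0 (Suc d) = 0" "\<And>s. F (Suc s) 0 = 0"
    and F_Suc: "\<And>s d. F (Suc s) (Suc d) = q * F s d + (1 - q) * F (s + 2) d + b s d"
    and b: "\<And>s. b s sums \<beta> s"
    and \<phi>: "\<And>s. \<phi> (Suc s) = q * \<phi> s + (1 - q) * \<phi> (s + 2) + \<beta> s"
    and lim: "\<phi> \<longlonglongrightarrow> 0"
  shows "F s sums \<phi> s"
proof -
  have F_0: "F 0 sums \<phi> 0"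
    using sums_If_finite_set[of "{0}" "F 0"] F0
    by (metis (no_types, lifting) not0_implies_Suc sums_0 sums_Suc_iff add_cancel_right_left)
  \<comment> \<open>Splitting off the first goal turns truncation at \<open>N + 1\<close> into
    truncation at \<open>N\<close> for the two neighbouring deficits, hence the arbitrary
    \<open>s\<close>.\<close>
  have bound: "(\<Sum>d<N. F s d) \<le> \<phi> s" for s N
  proof (induction N arbitrary: s)
    case 0
    then show ?case using nonneg by simp
  next
    case (Suc N)
    show ?case
    proof (cases s)
      case 0
      have "(\<Sum>d<Suc N. F 0 d) = \<phi> 0"
        using F0 by (subst sum.lessThan_Suc_shift) simp
      then show ?thesis using 0 by simp
    next
      case (Suc s')
      have "(\<Sum>d<N. b s' d) \<le> \<beta> s'"
        using b[of s'] nonneg(2) by (metis sum_le_suminf sums_iff finite_lessThan)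
      moreover have "q * (\<Sum>d<N. F s' d) \<le> q * \<phi> s'"
        "(1 - q) * (\<Sum>d<N. F (s' + 2) d) \<le> (1 - q) * \<phi> (s' + 2)"
        using Suc.IH q by (auto intro: mult_left_mono)
      moreover have "(\<Sum>d<Suc N. F s d) =
          q * (\<Sum>d<N. F s' d) + (1 - q) * (\<Sum>d<N. F (s' + 2) d) + (\<Sum>d<N. b s' d)"
        using F0 F_Suc Suc by (subst sum.lessThan_Suc_shift) (simp add: sum.distrib sum_distrib_left)
      ultimately show ?thesis using \<phi>[of s'] unfolding Suc by linarith
    qed
  qed
  have summable: "summable (F s)" for s
    using nonneg bound[of s "Suc _"] unfolding lessThan_Suc_atMost
    by (intro bounded_imp_summable[where B = "\<phi> s"]) auto
  define M where "M s = suminf (F s)" for s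
  have M: "F s sums M s" for s using summable by (simp add: M_def summable_sums)
  have M_le: "M s \<le> \<phi> s" for s
    unfolding M_def using summable bound by (intro suminf_le_const) auto
  have M_ge: "M s \<ge> 0" for s
    unfolding M_def using summable nonneg by (intro suminf_nonneg) auto
  have M_Suc: "M (Suc s) = q * M s + (1 - q) * M (s + 2) + \<beta> s" for s
  proof -
    have "(\<lambda>d. F (Suc s) (Suc d)) sums (q * M s + (1 - q) * M (s + 2) + \<beta> s)"
      unfolding F_Suc by (intro sums_add sums_mult M b)
    then have "F (Suc s) sums (q * M s + (1 - q) * M (s + 2) + \<beta> s)"
      using F0(3) by (simp add: sums_Suc_iff)
    then show ?thesis using M sums_unique2 by blast
  qed
  have "\<phi> s - M s = 0"
  proof (rule walk_harmonic_unique[where e = "\<lambda>s. \<phi> s - M s" and q = q])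
    show "\<phi> 0 - M 0 = 0" using F_0 M[of 0] sums_unique2 by fastforce
    show "(\<lambda>s. \<phi> s - M s) \<longlonglongrightarrow> 0"
      by (rule tendsto_sandwich[OF _ _ tendsto_const lim]) (use M_le M_ge in auto)
  qed (use q \<phi> M_Suc in \<open>auto simp: algebra_simps\<close>)
  then show ?thesis using M[of s] by simp
qed

text \<open>Three instances of \<open>walk_sums\<close>, where the source term of each moment
  consists of the moments below it. Since \<open>r < 1\<close>, the stated solutions decay; this
  singles them out, as the constant 1 also solves the homogeneous recursion.\<close>

lemma first_passage_sums:
  assumes q: "0 < q" "q < 1 / 2"
  shows "first_passage q s sums (q / (1 - q)) ^ s"
    and "(\<lambda>d. real d * first_passage q s d) sums (real s / (1 - 2 * q) * (q / (1 - q)) ^ s)"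
    and "(\<lambda>d. real d ^ 2 * first_passage q s d) sums
      ((real s ^ 2 / (1 - 2 * q) ^ 2 + 4 * q * (1 - q) * real s / (1 - 2 * q) ^ 3) * (q / (1 - q)) ^ s)"
proof -
  define r where "r = q / (1 - q)"
  define \<delta> where "\<delta> = 1 - 2 * q"
  have r: "0 < r" "r < 1" using q by (auto simp: r_def field_simps)
  have \<delta>: "\<delta> > 0" using q by (simp add: \<delta>_def)
  have pr: "(1 - q) * r = q" using q by (simp add: r_def)
  \<comment> \<open>\<open>r\<close> is a root of \<open>q + (1 - q) * x ^ 2 = x\<close>, so the
    powers of \<open>r\<close> are harmonic for the walk.\<close>
  have qpr: "q + (1 - q) * r ^ 2 = r"
  proof -
    have "(1 - q) * r ^ 2 = q * r" using arg_cong[OF pr, of "\<lambda>x. x * r"] by (simp add: power2_eq_square)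
    moreover have "q = r - q * r" using pr by (simp add: algebra_simps)
    ultimately show ?thesis by linarith
  qed
  note fp_nonneg = first_passage_nonneg[of q]
  have lim0: "(\<lambda>s. r ^ s) \<longlonglongrightarrow> 0" using r by (intro LIMSEQ_power_zero) auto
  have lim1: "(\<lambda>s. real s * r ^ s) \<longlonglongrightarrow> 0"
    using r by (intro powser_times_n_limit_0) auto
  have lim2: "(\<lambda>s. real s ^ 2 * r ^ s) \<longlonglongrightarrow> 0"
  proof -
    have "(\<lambda>s. (real s * sqrt r ^ s) ^ 2) \<longlonglongrightarrow> 0 ^ 2"
      using r by (intro tendsto_power powser_times_n_limit_0) auto
    moreover have "(real s * sqrt r ^ s) ^ 2 = real s ^ 2 * r ^ s" for s
      using r by (simp add: power_mult_distrib flip: power_mult) (simp add: mult.commute[of s] power_mult)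
    ultimately show ?thesis by simp
  qed
  have 0: "first_passage q s sums (r ^ s)" for s
  proof (rule walk_sums[where b = "\<lambda>_ _. 0" and \<beta> = "\<lambda>_. 0" and \<phi> = "\<lambda>s. r ^ s" and q = q])
    fix s show "r ^ Suc s = q * r ^ s + (1 - q) * r ^ (s + 2) + 0"
      using arg_cong[OF qpr, of "\<lambda>x. x * r ^ s"] by (simp add: algebra_simps power_add power2_eq_square)
  qed (use q r lim0 fp_nonneg in auto)
  have 1: "(\<lambda>d. real d * first_passage q s d) sums (real s / \<delta> * r ^ s)" for s
  \<comment> \<open>From \<open>d + 1 = d + 1 * 1\<close>: the source is the zeroth moment, shifted
    by one goal. The shift loses nothing, because a positive deficit cannot be made up after 0
    goals.\<close>
  proof (rule walk_sums[where b = "\<lambda>s d. first_passage q (Suc s) (Suc d)"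
        and \<beta> = "\<lambda>s. r ^ Suc s" and \<phi> = "\<lambda>s. real s / \<delta> * r ^ s" and q = q])
    fix s show "(\<lambda>d. first_passage q (Suc s) (Suc d)) sums r ^ Suc s"
      using 0[of "Suc s"] by (simp add: sums_Suc_iff del: first_passage.simps(3))
    have "real (Suc s) / \<delta> * r = q * (real s / \<delta>) + (1 - q) * (real (s + 2) / \<delta> * r ^ 2) + r"
      using \<delta> q by (simp add: r_def \<delta>_def divide_simps) (simp add: algebra_simps power2_eq_square)
    then have "real (Suc s) / \<delta> * r * r ^ s = (q * (real s / \<delta>) + (1 - q) * (real (s + 2) / \<delta> * r ^ 2) + r) * r ^ s"
      by simp
    then show "real (Suc s) / \<delta> * r ^ Suc s =
        q * (real s / \<delta> * r ^ s) + (1 - q) * (real (s + 2) / \<delta> * r ^ (s + 2)) + r ^ Suc s"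
      by (simp add: algebra_simps power_add power2_eq_square)
    show "(\<lambda>s. real s / \<delta> * r ^ s) \<longlonglongrightarrow> 0"
      using tendsto_mult_right_zero[OF lim1, of "1 / \<delta>"] by simp
    show "0 \<le> first_passage q (Suc s) (Suc d)" for d using fp_nonneg q by simp
  qed (use q r \<delta> fp_nonneg in \<open>auto simp: algebra_simps\<close>)
  define \<phi> where "\<phi> s = (real s ^ 2 / \<delta> ^ 2 + 4 * q * (1 - q) * real s / \<delta> ^ 3) * r ^ s" for s
  have 2: "(\<lambda>d. real d ^ 2 * first_passage q s d) sums \<phi> s" for s
  \<comment> \<open>From \<open>(d + 1) ^ 2 = d ^ 2 + 2 * (d + 1) - 1\<close>, written in
    \<open>d + 1\<close> so that the source is a combination of the shifted first and zeroth
    moments.\<close>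
  proof (rule walk_sums[where b = "\<lambda>s d. 2 * (real (Suc d) * first_passage q (Suc s) (Suc d)) - first_passage q (Suc s) (Suc d)"
        and \<beta> = "\<lambda>s. 2 * (real (Suc s) / \<delta> * r ^ Suc s) - r ^ Suc s" and \<phi> = \<phi> and q = q])
    fix s d :: nat
    show "(\<lambda>d. 2 * (real (Suc d) * first_passage q (Suc s) (Suc d)) - first_passage q (Suc s) (Suc d)) sums
        (2 * (real (Suc s) / \<delta> * r ^ Suc s) - r ^ Suc s)"
      using 0[of "Suc s"] 1[of "Suc s"]
      by (intro sums_diff sums_mult)
         (simp_all add: sums_Suc_iff[of "\<lambda>d. real d * first_passage q (Suc s) d"]
           sums_Suc_iff[of "first_passage q (Suc s)"] del: first_passage.simps(3) of_nat_Suc)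
    let ?f = "\<lambda>s. (real s ^ 2 / \<delta> ^ 2 + 4 * q * (1 - q) * real s / \<delta> ^ 3)"
    have "?f (Suc s) * r = q * ?f s + (1 - q) * (?f (s + 2) * r ^ 2) + (2 * (real (Suc s) / \<delta> * r) - r)"
      using \<delta> q by (simp add: r_def \<delta>_def divide_simps) (simp add: algebra_simps eval_nat_numeral)
    then have "?f (Suc s) * r * r ^ s = (q * ?f s + (1 - q) * (?f (s + 2) * r ^ 2) + (2 * (real (Suc s) / \<delta> * r) - r)) * r ^ s"
      by simp
    then show "\<phi> (Suc s) = q * \<phi> s + (1 - q) * \<phi> (s + 2) + (2 * (real (Suc s) / \<delta> * r ^ Suc s) - r ^ Suc s)"
      by (simp add: \<phi>_def algebra_simps power_add power2_eq_square del: of_nat_Suc)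
    show "\<phi> \<longlonglongrightarrow> 0"
    proof -
      have "(\<lambda>s. 1 / \<delta> ^ 2 * (real s ^ 2 * r ^ s) + 4 * q * (1 - q) / \<delta> ^ 3 * (real s * r ^ s)) \<longlonglongrightarrow>
          1 / \<delta> ^ 2 * 0 + 4 * q * (1 - q) / \<delta> ^ 3 * 0"
        by (intro tendsto_intros lim1 lim2)
      then show ?thesis by (simp add: \<phi>_def[abs_def] algebra_simps)
    qed
    show "0 \<le> \<phi> s" using q r \<delta> by (simp add: \<phi>_def)
    have "0 \<le> (2 * real (Suc d) - 1) * first_passage q (Suc s) (Suc d)"
      using fp_nonneg q by (intro mult_nonneg_nonneg) auto
    then show "0 \<le> 2 * (real (Suc d) * first_passage q (Suc s) (Suc d)) - first_passage q (Suc s) (Suc d)"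
      by (simp only: left_diff_distrib mult.assoc mult_1)
  qed (use q r fp_nonneg in \<open>auto simp: algebra_simps power2_eq_square \<phi>_def\<close>)
  show "first_passage q s sums (q / (1 - q)) ^ s"
    "(\<lambda>d. real d * first_passage q s d) sums (real s / (1 - 2 * q) * (q / (1 - q)) ^ s)"
    "(\<lambda>d. real d ^ 2 * first_passage q s d) sums
      ((real s ^ 2 / (1 - 2 * q) ^ 2 + 4 * q * (1 - q) * real s / (1 - 2 * q) ^ 3) * (q / (1 - q)) ^ s)"
    using 0 1 2 by (simp_all add: r_def \<delta>_def \<phi>_def)
qed

section \<open>The law of the game\<close>

lemma space_goals_space [simp]: "space (goals_space q) = UNIV"
  by (simp add: goals_space_def space_stream_space)

lemma prob_space_goals_space: "prob_space (goals_space q)"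
  unfolding goals_space_def by (intro prob_space.prob_space_stream_space prob_space_measure_pmf)

lemma measurable_shd_goals [measurable]: "shd \<in> measurable (goals_space q) (count_space UNIV)"
  using measurable_shd[of "measure_pmf (bernoulli_pmf q)"]
  by (simp add: goals_space_def)

lemma measurable_stl_goals [measurable]: "stl \<in> measurable (goals_space q) (goals_space q)"
  unfolding goals_space_def by measurable

text \<open>The stream space is one goal followed by an independent copy of the stream space. The
  laws of Phase I and of catching up are inductions over this identity.\<close>

lemma prob_first_goal:
  assumes q: "0 \<le> q" "q \<le> 1" and P: "Measurable.pred (goals_space q) P"
  shows "measure (goals_space q) {\<omega>. P \<omega>} =
    q * measure (goals_space q) {\<omega>. P (True ## \<omega>)} +
    (1 - q) * measure (goals_space q) {\<omega>. P (False ## \<omega>)}"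
proof -
  let ?M = "goals_space q"
  interpret prob_space ?M by (rule prob_space_goals_space)
  have P': "{\<omega>. P \<omega>} \<in> sets ?M" using P by (simp add: pred_def)
  have "emeasure ?M {\<omega>. P \<omega>} = (\<integral>\<^sup>+ b. emeasure ?M {\<omega>. P (b ## \<omega>)} \<partial>bernoulli_pmf q)"
    using P' unfolding goals_space_def
    by (subst prob_space.emeasure_stream_space[OF prob_space_measure_pmf]) (auto simp: space_stream_space)
  also have "\<dots> = ennreal (q * measure ?M {\<omega>. P (True ## \<omega>)} + (1 - q) * measure ?M {\<omega>. P (False ## \<omega>)})"
    using q by (simp add: emeasure_eq_measure ennreal_mult' ennreal_plus mult.commute flip: ennreal_minus)
  finally show ?thesis using q
    by (intro measure_eq_emeasure_eq_ennreal) auto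
qed

section \<open>Scores and Phase I when the first goal is split off\<close>

lemma goals_B_0 [simp]: "goals_B \<omega> 0 = 0" and goals_G_0 [simp]: "goals_G \<omega> 0 = 0"
  by (simp_all add: goals_B_def goals_G_def)

lemma card_less_Suc_shift:
  "card {i. i < Suc k \<and> P i} = (if P 0 then 1 else 0) + card {i. i < k \<and> P (Suc i)}"
proof -
  have "{i. i < Suc k \<and> P i} = (if P 0 then {0} else {}) \<union> Suc ` {i. i < k \<and> P (Suc i)}"
    by (auto simp: image_iff less_Suc_eq_0_disj)
  moreover have "card (Suc ` {i. i < k \<and> P (Suc i)}) = card {i. i < k \<and> P (Suc i)}"
    by (intro card_image) auto
  ultimately show ?thesis by (auto simp: card_insert_if)
qed

lemma goals_B_Suc: "goals_B \<omega> (Suc k) = (if shd \<omega> then 1 else 0) + goals_B (stl \<omega>) k"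
  and goals_G_Suc: "goals_G \<omega> (Suc k) = (if shd \<omega> then 0 else 1) + goals_G (stl \<omega>) k"
  unfolding goals_B_def goals_G_def by (simp_all add: card_less_Suc_shift)

lemma goals_B_add: "goals_B \<omega> (k + d) = goals_B \<omega> k + goals_B (sdrop k \<omega>) d"
  and goals_G_add: "goals_G \<omega> (k + d) = goals_G \<omega> k + goals_G (sdrop k \<omega>) d"
  by (induction k arbitrary: \<omega>) (simp_all add: goals_B_Suc goals_G_Suc)

lemma phase1_ends_0 [simp]: "phase1_ends 0 \<omega>"
  unfolding phase1_ends_def using goals_G_0 by blast

lemma phase1_length_0 [simp]: "phase1_length 0 \<omega> = 0"
  by (simp add: phase1_length_def)

lemma phase1_B_0 [simp]: "phase1_B 0 \<omega> = 0"
  by (simp add: phase1_B_def)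

lemma ex_nat_0_Suc: "(\<exists>k::nat. P k) \<longleftrightarrow> P 0 \<or> (\<exists>k. P (Suc k))"
  by (metis not0_implies_Suc)

lemma phase1_ends_Stream:
  "phase1_ends (Suc n) (True ## \<omega>) \<longleftrightarrow> phase1_ends (Suc n) \<omega>"
  "phase1_ends (Suc n) (False ## \<omega>) \<longleftrightarrow> phase1_ends n \<omega>"
  unfolding phase1_ends_def by (subst ex_nat_0_Suc, simp add: goals_G_Suc)+

lemma phase1_length_Stream:
  assumes "phase1_ends (Suc n) (b ## \<omega>)"
  shows "phase1_length (Suc n) (b ## \<omega>) = Suc (phase1_length (if b then Suc n else n) \<omega>)"
proof -
  obtain k where k: "goals_G (b ## \<omega>) k = Suc n"
    using assms by (auto simp: phase1_ends_def)
  show ?thesis unfolding phase1_length_def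
    by (subst Least_Suc[where P = "\<lambda>k. goals_G (b ## \<omega>) k = Suc n", OF k]) (simp_all add: goals_G_Suc)
qed

lemma phase1_B_Stream:
  assumes "phase1_ends (Suc n) (b ## \<omega>)"
  shows "phase1_B (Suc n) (b ## \<omega>) = (if b then Suc (phase1_B (Suc n) \<omega>) else phase1_B n \<omega>)"
  using phase1_length_Stream[OF assms] by (simp add: phase1_B_def goals_B_Suc)

text \<open>The event \<open>P\<close> about the goals after Phase I is carried through the
  induction. This yields the law of Phase I and its independence of what follows together, in place
  of a strong Markov property.\<close>

definition phase1_then :: "nat \<Rightarrow> nat \<Rightarrow> (bool stream \<Rightarrow> bool) \<Rightarrow> bool stream \<Rightarrow> bool" where
  "phase1_then n m P \<omega> \<longleftrightarrow>
     phase1_ends n \<omega> \<and> phase1_B n \<omega> = m \<and> P (sdrop (phase1_length n \<omega>) \<omega>)"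

lemma phase1_then_0 [simp]: "phase1_then 0 m P = (\<lambda>\<omega>. m = 0 \<and> P \<omega>)"
  by (auto simp: phase1_then_def fun_eq_iff)

lemma phase1_then_Stream:
  "phase1_then (Suc n) 0 P (True ## \<omega>) \<longleftrightarrow> False"
  "phase1_then (Suc n) (Suc m) P (True ## \<omega>) \<longleftrightarrow> phase1_then (Suc n) m P \<omega>"
  "phase1_then (Suc n) m P (False ## \<omega>) \<longleftrightarrow> phase1_then n m P \<omega>"
  by (auto simp: phase1_then_def phase1_B_Stream phase1_length_Stream phase1_ends_Stream)

text \<open>Measurability may be checked separately for each value of the first goal, so it follows
  the same recursions as the probabilities.\<close>

lemma pred_goals_StreamI:
  assumes "Measurable.pred (goals_space q) (\<lambda>\<omega>. P (True ## \<omega>))"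
    and "Measurable.pred (goals_space q) (\<lambda>\<omega>. P (False ## \<omega>))"
  shows "Measurable.pred (goals_space q) P"
proof -
  define Q where "Q \<omega> \<longleftrightarrow> (shd \<omega> \<and> P (True ## stl \<omega>)) \<or> (\<not> shd \<omega> \<and> P (False ## stl \<omega>))" for \<omega>
  have "P = Q"
    unfolding Q_def by (rule ext) (metis (full_types) stream.collapse)
  note [measurable] = measurable_compose[OF measurable_stl_goals assms(1)]
    measurable_compose[OF measurable_stl_goals assms(2)]
  have "Measurable.pred (goals_space q) Q"
    unfolding Q_def by measurable
  with \<open>P = Q\<close> show ?thesis by simp
qed

lemma pred_phase1_then:
  assumes "Measurable.pred (goals_space q) P"
  shows "Measurable.pred (goals_space q) (phase1_then n m P)"
proof (induction "n + m" arbitrary: n m rule: less_induct)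
  case less
  show ?case
  proof (cases n)
    case 0
    then show ?thesis using assms by simp
  next
    case (Suc n')
    show ?thesis
      by (cases m; rule pred_goals_StreamI) (auto simp: Suc phase1_then_Stream intro!: less)
  qed
qed

text \<open>The negative binomial law times the probability of the future event: splitting off the
  first goal lowers \<open>m\<close> or \<open>n\<close> by one, and Pascal's rule recombines the
  two coefficients.\<close>

lemma prob_phase1_then:
  fixes q :: real
  assumes q: "0 \<le> q" "q \<le> 1" and P: "Measurable.pred (goals_space q) P"
  shows "measure (goals_space q) {\<omega>. phase1_then n m P \<omega>} =
    real ((n + m - 1) choose m) * (1 - q) ^ n * q ^ m * measure (goals_space q) {\<omega>. P \<omega>}"
proof (induction "n + m" arbitrary: n m rule: less_induct)
  case less
  note first = prob_first_goal[OF q pred_phase1_then[OF P]]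
  show ?case
  proof (cases n)
    case 0
    \<comment> \<open>Truncated subtraction is right here: the coefficient
      \<open>m - 1 choose m\<close> is 1 for \<open>m = 0\<close> and 0 for
      \<open>m > 0\<close>.\<close>
    then show ?thesis by (cases m) auto
  next
    case n: (Suc n')
    show ?thesis
    proof (cases m)
      case 0
      then show ?thesis
        using less[of n' 0] n by (subst first) (simp add: phase1_then_Stream)
    next
      case m: (Suc m')
      let ?\<mu> = "measure (goals_space q)"
      have "?\<mu> {\<omega>. phase1_then n m' P \<omega>} =
          real (n' + m' choose m') * (1 - q) ^ n * q ^ m' * ?\<mu> {\<omega>. P \<omega>}"
        using less[of n m'] n m by simp
      moreover have "?\<mu> {\<omega>. phase1_then n' m P \<omega>} =
          real (n' + m' choose m) * (1 - q) ^ n' * q ^ m * ?\<mu> {\<omega>. P \<omega>}"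
        using less[of n' m] n m by simp
      moreover have "?\<mu> {\<omega>. phase1_then n m P \<omega>} =
          q * ?\<mu> {\<omega>. phase1_then n m' P \<omega>} + (1 - q) * ?\<mu> {\<omega>. phase1_then n' m P \<omega>}"
        using n m by (subst first) (simp add: phase1_then_Stream)
      ultimately show ?thesis
        using n m by (simp only:) (simp add: algebra_simps)
    qed
  qed
qed

lemma pred_phase1_ends: "Measurable.pred (goals_space q) (phase1_ends n)"
proof -
  have "Measurable.pred (goals_space q) (\<lambda>\<omega>. \<exists>m. phase1_then n m (\<lambda>_. True) \<omega>)"
    using pred_phase1_then[where P = "\<lambda>_. True"] by measurable
  then show ?thesis by (simp add: phase1_then_def)
qed

text \<open>The probability \<open>x\<close> of ending satisfies \<open>x = q * x + (1 - q)\<close>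
  by the first goal and the induction hypothesis, and \<open>q < 1\<close> forces
  \<open>x = 1\<close>.\<close>

lemma prob_phase1_ends:
  assumes q: "0 \<le> q" "q < 1"
  shows "measure (goals_space q) {\<omega>. phase1_ends n \<omega>} = 1"
proof (induction n)
  case 0
  then show ?case using prob_space.prob_space[OF prob_space_goals_space, of q] by simp
next
  case (Suc n)
  have "measure (goals_space q) {\<omega>. phase1_ends (Suc n) \<omega>} =
      q * measure (goals_space q) {\<omega>. phase1_ends (Suc n) \<omega>} + (1 - q)"
    using q Suc by (subst prob_first_goal[OF _ _ pred_phase1_ends]) (simp_all add: phase1_ends_Stream)
  then have "(1 - q) * (measure (goals_space q) {\<omega>. phase1_ends (Suc n) \<omega>} - 1) = 0"
    by (simp add: algebra_simps)
  then show ?case using q by simp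
qed

text \<open>First passage in the goals after Phase I alone, with the old deficit \<open>s\<close>
  added to the score of G; the sum avoids truncated subtraction.\<close>

definition catches_up :: "nat \<Rightarrow> nat \<Rightarrow> bool stream \<Rightarrow> bool" where
  "catches_up s d \<omega> \<longleftrightarrow>
     goals_B \<omega> d = goals_G \<omega> d + s \<and> (\<forall>d'<d. goals_B \<omega> d' \<noteq> goals_G \<omega> d' + s)"

lemma catches_up_0: "catches_up s 0 \<omega> \<longleftrightarrow> s = 0"
  by (auto simp: catches_up_def)

lemma catches_up_0_Suc: "\<not> catches_up 0 (Suc d) \<omega>"
  by (auto simp: catches_up_def)

lemma catches_up_Suc_Suc:
  "catches_up (Suc s) (Suc d) (True ## \<omega>) \<longleftrightarrow> catches_up s d \<omega>"
  "catches_up (Suc s) (Suc d) (False ## \<omega>) \<longleftrightarrow> catches_up (s + 2) d \<omega>"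
  by (auto simp: catches_up_def goals_B_Suc goals_G_Suc All_less_Suc2)

lemma pred_catches_up: "Measurable.pred (goals_space q) (catches_up s d)"
proof (induction d arbitrary: s)
  case 0
  then show ?case by (simp add: catches_up_0)
next
  case (Suc d)
  show ?case
    by (cases s; rule pred_goals_StreamI) (simp_all add: catches_up_0_Suc catches_up_Suc_Suc Suc)
qed

lemma prob_catches_up:
  assumes q: "0 \<le> q" "q \<le> 1"
  shows "measure (goals_space q) {\<omega>. catches_up s d \<omega>} = first_passage q s d"
proof (induction d arbitrary: s)
  case 0
  then show ?case
    using prob_space.prob_space[OF prob_space_goals_space, of q] by (simp add: catches_up_0)
next
  case (Suc d)
  then show ?case
    by (cases s; subst prob_first_goal[OF q pred_catches_up])
       (simp_all add: catches_up_0_Suc catches_up_Suc_Suc)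
qed

section \<open>Measurability of the scores, of Phase I and of the duration\<close>

lemma measurable_goals_B [measurable]: "(\<lambda>\<omega>. goals_B \<omega> k) \<in> measurable (goals_space q) (count_space UNIV)"
proof (induction k)
  case (Suc k)
  note [measurable] = measurable_compose[OF measurable_stl_goals Suc]
  show ?case unfolding goals_B_Suc by measurable
qed simp

lemma measurable_goals_G [measurable]: "(\<lambda>\<omega>. goals_G \<omega> k) \<in> measurable (goals_space q) (count_space UNIV)"
proof (induction k)
  case (Suc k)
  note [measurable] = measurable_compose[OF measurable_stl_goals Suc]
  show ?case unfolding goals_G_Suc by measurable
qed simp

lemma measurable_phase1_length [measurable]:
  "phase1_length n \<in> measurable (goals_space q) (count_space UNIV)"
  unfolding phase1_length_def by measurable

lemma measurable_phase1_B [measurable]: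
  "phase1_B n \<in> measurable (goals_space q) (count_space UNIV)"
  unfolding phase1_B_def
  by (rule measurable_compose_countable[OF measurable_goals_B measurable_phase1_length])

lemma pred_tied_after [measurable]: "Measurable.pred (goals_space q) (\<lambda>\<omega>. tied_after n \<omega> d)"
proof -
  \<comment> \<open>The random time at which the scores are read is split into its countably many
    values.\<close>
  have "tied_after n \<omega> d \<longleftrightarrow> (\<exists>l k. phase1_length n \<omega> = l \<and> goals_B \<omega> (l + d) = k \<and> goals_G \<omega> (l + d) = k)" for \<omega>
    by (auto simp: tied_after_def)
  then show ?thesis by (simp only:) measurable
qed

lemma measurable_phase2_duration [measurable]:
  "phase2_duration n \<in> measurable (goals_space q) (count_space UNIV)"
  unfolding phase2_duration_def by measurable

lemma pred_B_wins [measurable]: "Measurable.pred (goals_space q) (B_wins n)"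
  unfolding B_wins_def using pred_phase1_ends[measurable] by measurable

text \<open>If B is behind when Phase I ends, the scores are tied exactly when the remaining goals
  make up the deficit, and an attained \<open>LEAST\<close> is the first such time. Otherwise a win
  can only have duration 0.\<close>

lemma B_wins_duration_iff:
  "B_wins n \<omega> \<and> phase2_duration n \<omega> = d \<longleftrightarrow>
    (phase1_ends n \<omega> \<and> n \<le> phase1_B n \<omega> \<and> d = 0) \<or>
    (\<exists>m<n. phase1_then n m (catches_up (n - m) d) \<omega>)"
proof (cases "phase1_ends n \<omega> \<and> phase1_B n \<omega> < n")
  case True
  define L where "L = phase1_length n \<omega>"
  define s where "s = n - phase1_B n \<omega>"
  have "\<exists>k. goals_G \<omega> k = n" using True by (simp add: phase1_ends_def)
  then have "goals_G \<omega> L = n"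
    unfolding L_def phase1_length_def by (rule LeastI_ex)
  moreover have "goals_B \<omega> L = phase1_B n \<omega>" by (simp add: L_def phase1_B_def)
  ultimately have tied: "tied_after n \<omega> d \<longleftrightarrow> goals_B (sdrop L \<omega>) d = goals_G (sdrop L \<omega>) d + s" for d
    using True by (simp add: tied_after_def goals_B_add goals_G_add s_def flip: L_def) linarith
  have "(\<exists>d. tied_after n \<omega> d) \<and> (LEAST d. tied_after n \<omega> d) = d \<longleftrightarrow>
      tied_after n \<omega> d \<and> (\<forall>d'<d. \<not> tied_after n \<omega> d')"
    by (metis (mono_tags, lifting) LeastI_ex Least_le leD not_less_Least linorder_neqE_nat)
  also have "\<dots> \<longleftrightarrow> catches_up s d (sdrop L \<omega>)"
    by (simp add: tied catches_up_def)
  finally show ?thesis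
    using True by (auto simp: B_wins_def phase2_duration_def phase1_then_def L_def s_def)
next
  case False
  then show ?thesis by (auto simp: B_wins_def phase2_duration_def phase1_then_def)
qed

section \<open>The law of the duration on the event that B wins, and its moments\<close>

definition phase1_prob :: "real \<Rightarrow> nat \<Rightarrow> nat \<Rightarrow> real" where
  "phase1_prob q n m = real (n + m - 1 choose m) * (1 - q) ^ n * q ^ m"

lemma sets_phase1_then:
  "Measurable.pred (goals_space q) P \<Longrightarrow> {\<omega>. phase1_then n m P \<omega>} \<in> sets (goals_space q)"
  using pred_phase1_then[where q = q and P = P and n = n and m = m] by (simp add: pred_def)

lemma prob_Union_phase1_then:
  assumes q: "0 \<le> q" "q \<le> 1" and P: "\<And>m. Measurable.pred (goals_space q) (P m)"
  shows "measure (goals_space q) {\<omega>. \<exists>m<n. phase1_then n m (P m) \<omega>} =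
    (\<Sum>m<n. phase1_prob q n m * measure (goals_space q) {\<omega>. P m \<omega>})"
proof -
  interpret prob_space "goals_space q" by (rule prob_space_goals_space)
  have "{\<omega>. \<exists>m<n. phase1_then n m (P m) \<omega>} = (\<Union>m<n. {\<omega>. phase1_then n m (P m) \<omega>})"
    by auto
  also have "prob \<dots> = (\<Sum>m<n. prob {\<omega>. phase1_then n m (P m) \<omega>})"
  proof (rule finite_measure_finite_Union)
    show "(\<lambda>m. {\<omega>. phase1_then n m (P m) \<omega>}) ` {..<n} \<subseteq> events"
      using sets_phase1_then[OF P] by auto
    show "disjoint_family_on (\<lambda>m. {\<omega>. phase1_then n m (P m) \<omega>}) {..<n}"
      by (auto simp: disjoint_family_on_def phase1_then_def)
  qed simp
  also have "\<dots> = (\<Sum>m<n. phase1_prob q n m * prob {\<omega>. P m \<omega>})"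
    by (intro sum.cong refl) (simp add: prob_phase1_then[OF q P] phase1_prob_def)
  finally show ?thesis .
qed

text \<open>Phase I ends almost surely, so passing to the complement leaves a finite sum.\<close>

lemma prob_phase1_B_ge:
  assumes q: "0 \<le> q" "q < 1"
  shows "measure (goals_space q) {\<omega>. phase1_ends n \<omega> \<and> n \<le> phase1_B n \<omega>} =
    1 - (\<Sum>m<n. phase1_prob q n m)"
proof -
  interpret prob_space "goals_space q" by (rule prob_space_goals_space)
  note pred_phase1_ends[measurable]
  let ?A = "{\<omega>. phase1_ends n \<omega> \<and> n \<le> phase1_B n \<omega>}"
  let ?B = "{\<omega>. \<exists>m<n. phase1_then n m (\<lambda>_. True) \<omega>}"
  have B: "?B = {\<omega>. phase1_ends n \<omega> \<and> phase1_B n \<omega> < n}"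
    by (auto simp: phase1_then_def)
  have "{\<omega>\<in>space (goals_space q). phase1_ends n \<omega> \<and> n \<le> phase1_B n \<omega>} \<in> events"
    "{\<omega>\<in>space (goals_space q). phase1_ends n \<omega> \<and> phase1_B n \<omega> < n} \<in> events"
    by measurable
  then have "prob (?A \<union> ?B) = prob ?A + prob ?B"
    unfolding B by (intro finite_measure_Union) auto
  moreover have "?A \<union> ?B = {\<omega>. phase1_ends n \<omega>}" unfolding B by auto
  moreover have "prob ?B = (\<Sum>m<n. phase1_prob q n m)"
    using q prob_space by (subst prob_Union_phase1_then) auto
  ultimately show ?thesis using prob_phase1_ends[OF q, of n] by simp
qed

definition duration_prob :: "real \<Rightarrow> nat \<Rightarrow> nat \<Rightarrow> real" where
  "duration_prob q n d = measure (goals_space q) {\<omega>. B_wins n \<omega> \<and> phase2_duration n \<omega> = d}"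

lemma duration_prob_eq:
  assumes q: "0 \<le> q" "q < 1"
  shows "duration_prob q n d = (if d = 0 then 1 - (\<Sum>m<n. phase1_prob q n m) else 0) +
    (\<Sum>m<n. phase1_prob q n m * first_passage q (n - m) d)"
proof -
  interpret prob_space "goals_space q" by (rule prob_space_goals_space)
  note pred_phase1_ends[measurable]
  let ?A = "{\<omega>. phase1_ends n \<omega> \<and> n \<le> phase1_B n \<omega> \<and> d = 0}"
  let ?B = "{\<omega>. \<exists>m<n. phase1_then n m (catches_up (n - m) d) \<omega>}"
  have "?B = (\<Union>m<n. {\<omega>. phase1_then n m (catches_up (n - m) d) \<omega>})" by auto
  also have "\<dots> \<in> events" using sets_phase1_then[OF pred_catches_up] by auto
  finally have "?B \<in> events" .
  moreover have "{\<omega>\<in>space (goals_space q). phase1_ends n \<omega> \<and> n \<le> phase1_B n \<omega> \<and> d = 0} \<in> events"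
    by measurable
  ultimately have "prob (?A \<union> ?B) = prob ?A + prob ?B"
    by (intro finite_measure_Union) (auto simp: phase1_then_def)
  moreover have "?A \<union> ?B = {\<omega>. B_wins n \<omega> \<and> phase2_duration n \<omega> = d}"
    by (auto simp: B_wins_duration_iff)
  moreover have "prob ?A = (if d = 0 then 1 - (\<Sum>m<n. phase1_prob q n m) else 0)"
    using prob_phase1_B_ge[OF q] by simp
  moreover have "prob ?B = (\<Sum>m<n. phase1_prob q n m * first_passage q (n - m) d)"
    using q by (simp add: prob_Union_phase1_then pred_catches_up prob_catches_up)
  ultimately show ?thesis by (simp add: duration_prob_def)
qed

text \<open>The duration has countably many values, so the integral is a series. The indicator
  removes the streams on which the \<open>LEAST\<close> is not attained, and nonnegativity makes
  integrability unnecessary at this stage.\<close>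

lemma nn_integral_duration:
  assumes g: "\<And>d. 0 \<le> g d" and S: "(\<lambda>d. g d * duration_prob q n d) sums S"
  shows "(\<integral>\<^sup>+ \<omega>. ennreal (g (phase2_duration n \<omega>)) * indicator {\<omega>. B_wins n \<omega>} \<omega> \<partial>goals_space q)
    = ennreal S"
proof -
  interpret prob_space "goals_space q" by (rule prob_space_goals_space)
  let ?W = "\<lambda>d. {\<omega>. B_wins n \<omega> \<and> phase2_duration n \<omega> = d}"
  have "{\<omega>\<in>space (goals_space q). B_wins n \<omega> \<and> phase2_duration n \<omega> = d} \<in> events" for d
    by measurable
  then have W [measurable]: "?W d \<in> events" for d by simp
  have "ennreal (g (phase2_duration n \<omega>)) * indicator {\<omega>. B_wins n \<omega>} \<omega> =
      (\<Sum>d. ennreal (g d) * indicator (?W d) \<omega>)" for \<omega>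
    by (subst suminf_finite[of "{phase2_duration n \<omega>}"]) (auto simp: indicator_def)
  then have "(\<integral>\<^sup>+ \<omega>. ennreal (g (phase2_duration n \<omega>)) * indicator {\<omega>. B_wins n \<omega>} \<omega> \<partial>goals_space q)
      = (\<Sum>d. \<integral>\<^sup>+ \<omega>. ennreal (g d) * indicator (?W d) \<omega> \<partial>goals_space q)"
    by (simp add: nn_integral_suminf)
  also have "\<dots> = (\<Sum>d. ennreal (g d * duration_prob q n d))"
    using g by (simp add: nn_integral_cmult_indicator emeasure_eq_measure duration_prob_def ennreal_mult')
  also have "\<dots> = ennreal S"
    using S g by (intro suminf_ennreal_eq) (auto simp: duration_prob_def)
  finally show ?thesis .
qed

lemma phase2_variance_eq:
  assumes w: "duration_prob q n sums w" and "0 < w"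
    and e1: "(\<lambda>d. real d * duration_prob q n d) sums e1"
    and e2: "(\<lambda>d. real d ^ 2 * duration_prob q n d) sums e2"
  shows "phase2_variance q n = e2 / w - (e1 / w) ^ 2"
proof -
  let ?M = "goals_space q" and ?K = "given_B_wins q n"
  interpret prob_space ?M by (rule prob_space_goals_space)
  have "{\<omega>\<in>space ?M. B_wins n \<omega>} \<in> events" by measurable
  then have W [measurable]: "{\<omega>. B_wins n \<omega>} \<in> events" by simp
  have K: "?K = uniform_measure ?M {\<omega>. B_wins n \<omega>}"
    by (simp add: given_B_wins_def)
  have W_w: "emeasure ?M {\<omega>. B_wins n \<omega>} = ennreal w"
    using nn_integral_duration[of "\<lambda>_. 1" q n w] w by simp
  interpret K: prob_space ?K
    unfolding K using W_w \<open>0 < w\<close> by (intro prob_space_uniform_measure) auto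
  have sets_K: "sets ?K = sets ?M" by (simp add: K)
  have D [measurable]: "phase2_duration n \<in> measurable ?K (count_space UNIV)"
    using measurable_phase2_duration measurable_cong_sets[OF sets_K refl] by blast
  \<comment> \<open>A finite nonnegative integral gives integrability and value at once;
    conditioning divides by the winning probability \<open>w\<close>, itself the case
    \<open>g = 1\<close>.\<close>
  have moment: "has_bochner_integral ?K (\<lambda>\<omega>. g (phase2_duration n \<omega>)) (S / w)"
    if g: "\<And>d. 0 \<le> g d" and S: "(\<lambda>d. g d * duration_prob q n d) sums S" for g S
  proof (rule has_bochner_integral_nn_integral)
    have "0 \<le> S"
      using sums_le[OF _ sums_zero S] g by (simp add: duration_prob_def)
    then show "0 \<le> S / w" using \<open>0 < w\<close> by simp
    have "(\<integral>\<^sup>+ \<omega>. ennreal (g (phase2_duration n \<omega>)) \<partial>?K) =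
        (\<integral>\<^sup>+ \<omega>. ennreal (g (phase2_duration n \<omega>)) * indicator {\<omega>. B_wins n \<omega>} \<omega> \<partial>?M) / ennreal w"
      unfolding K W_w[symmetric] by (rule nn_integral_uniform_measure) measurable
    also have "\<dots> = ennreal (S / w)"
      using \<open>0 < w\<close> \<open>0 \<le> S\<close> by (simp add: nn_integral_duration[OF g S] divide_ennreal)
    finally show "(\<integral>\<^sup>+ \<omega>. ennreal (g (phase2_duration n \<omega>)) \<partial>?K) = ennreal (S / w)" .
  qed (use g in auto)
  have 1: "has_bochner_integral ?K (\<lambda>\<omega>. real (phase2_duration n \<omega>)) (e1 / w)"
    by (rule moment[of real]) (use e1 in auto)
  have 2: "has_bochner_integral ?K (\<lambda>\<omega>. real (phase2_duration n \<omega>) ^ 2) (e2 / w)"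
    by (rule moment[of "\<lambda>d. real d ^ 2"]) (use e2 in auto)
  show ?thesis
    unfolding phase2_variance_def using 1 2
    by (subst K.variance_eq) (auto simp: has_bochner_integral_iff)
qed

section \<open>Reduction to truncated binomial sums\<close>

text \<open>
  Given that B wins from behind, the deficit \<open>n - k\<close> after Phase I has the law of the deficit in
  the game with the two scoring probabilities exchanged.
\<close>

definition deficit_weight :: "real \<Rightarrow> nat \<Rightarrow> nat \<Rightarrow> real" where
  "deficit_weight q n k = real (n + k - 1 choose k) * q ^ n * (1 - q) ^ k"

definition deficit_moment :: "real \<Rightarrow> nat \<Rightarrow> nat \<Rightarrow> real" where
  "deficit_moment q a n = (\<Sum>k<n. real (n - k) ^ a * deficit_weight q n k)"

text \<open>The catching-up probability from deficit \<open>n - k\<close> moves \<open>n - k\<close>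
  factors from \<open>1 - q\<close> to \<open>q\<close>, which exchanges the two scoring
  probabilities.\<close>

lemma phase1_prob_tilt:
  assumes "q < 1" "k \<le> n"
  shows "phase1_prob q n k * (q / (1 - q)) ^ (n - k) = deficit_weight q n k"
proof -
  obtain j where "n = k + j" using assms le_Suc_ex by blast
  then show ?thesis using assms
    by (simp add: phase1_prob_def deficit_weight_def power_add power_divide)
qed

lemma phase1_prob_swap: "phase1_prob q n k = deficit_weight (1 - q) n k"
  by (simp add: phase1_prob_def deficit_weight_def)

lemma deficit_weight_Suc:
  assumes "n \<ge> 1"
  shows "real (Suc k) * deficit_weight q n (Suc k) = real (n + k) * (1 - q) * deficit_weight q n k"
proof -
  obtain j where n: "n = Suc j" using assms by (cases n) auto
  have "Suc k * (Suc (j + k) choose Suc k) = Suc (j + k) * (j + k choose k)"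
    using Suc_times_binomial_eq[of "j + k" k] by (simp add: mult.commute)
  then have "real (Suc k) * real (Suc (j + k) choose Suc k) = real (Suc (j + k)) * real (j + k choose k)"
    by (metis of_nat_mult)
  then show ?thesis unfolding deficit_weight_def n by simp
qed

lemma central_binomial_half:
  assumes "n \<ge> 1"
  shows "Suc n + n - 1 choose n = 2 * (n + n - 1 choose n)"
proof -
  obtain j where n: "n = Suc j" using assms by (cases n) auto
  have "Suc (Suc (2 * j)) choose Suc j = 2 * (Suc (2 * j) choose Suc j)"
    using binomial_symmetric[of j "Suc (2 * j)"] by simp
  moreover have "Suc n + n - 1 = Suc (Suc (2 * j))" "n + n - 1 = Suc (2 * j)" using n by auto
  ultimately show ?thesis using n by metis
qed
text \<open>Pascal's rule relates the weights for \<open>n\<close> and \<open>n + 1\<close>. After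
  summation only boundary terms differ, and these agree up to the factor \<open>2 * q\<close>
  because a central binomial coefficient is twice its neighbour in the row above.\<close>

lemma deficit_moment_0_Suc:
  assumes "q \<noteq> 0" "n \<ge> 1"
  shows "deficit_moment q 0 n = deficit_moment q 0 (Suc n) + (1 - 2 * q) * deficit_weight q n n"
proof -
  define w where "w = deficit_weight q n"
  define w' where "w' = deficit_weight q (Suc n)"
  have pascal: "w' (Suc k) = q * w (Suc k) + (1 - q) * w' k" for k
    using assms by (cases n) (simp_all add: w_def w'_def deficit_weight_def algebra_simps)
  have "(\<Sum>k<n. w' (Suc k)) = q * (\<Sum>k<n. w (Suc k)) + (1 - q) * (\<Sum>k<n. w' k)"
    by (simp only: pascal sum.distrib sum_distrib_left)
  moreover have "w' 0 = q * w 0" by (simp add: w_def w'_def deficit_weight_def)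
  ultimately have 1: "(\<Sum>k<Suc n. w' k) = q * (\<Sum>k<Suc n. w k) + (1 - q) * (\<Sum>k<n. w' k)"
    by (simp add: sum.lessThan_Suc_shift distrib_left del: sum.lessThan_Suc)
  have 2: "w' n = 2 * q * w n"
    using central_binomial_half[OF \<open>n \<ge> 1\<close>, THEN arg_cong, of real]
    by (simp only: w_def w'_def deficit_weight_def of_nat_mult of_nat_numeral power_Suc mult_ac)
  \<comment> \<open>\<open>A\<close> and \<open>C\<close> are the sums over \<open>k < n\<close> of
    the weights for \<open>n\<close> and \<open>n + 1\<close>, \<open>B\<close> is the full sum for
    \<open>n + 1\<close>, and \<open>v\<close>, \<open>v'\<close> are the boundary weights;
    eliminating \<open>C\<close> is linear algebra.\<close>
  have "q * (A - B - (1 - 2 * q) * v) = 0"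
    if "B = q * (A + v) + (1 - q) * C" "v' = 2 * q * v" "B = C + v'" for A B C v v' :: real
  proof -
    have "C = B - 2 * q * v" using that by simp
    from that(1)[unfolded this] show ?thesis by (simp add: algebra_simps)
  qed
  from this[OF 1[unfolded sum.lessThan_Suc[of w]] 2 sum.lessThan_Suc]
  have "q * ((\<Sum>k<n. w k) - (\<Sum>k<Suc n. w' k) - (1 - 2 * q) * w n) = 0" .
  then have "deficit_moment q 0 n - deficit_moment q 0 (Suc n) - (1 - 2 * q) * w n = 0"
    using \<open>q \<noteq> 0\<close> by (simp add: deficit_moment_def w_def w'_def)
  then show ?thesis by (simp add: w_def)
qed

text \<open>The Chaundy-Bullard identity.\<close>

lemma deficit_moment_0_swap:
  assumes q: "0 < q" "q < 1" and "n \<ge> 1"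
  shows "deficit_moment q 0 n + deficit_moment (1 - q) 0 n = 1"
  using \<open>n \<ge> 1\<close>
proof (induction n rule: dec_induct)
  case base
  then show ?case by (simp add: deficit_moment_def deficit_weight_def)
next
  case (step n)
  \<comment> \<open>The boundary weight is symmetric in \<open>q\<close> and \<open>1 - q\<close>
    while \<open>1 - 2 * q\<close> changes sign, so the two increments cancel and the sum is
    constant in \<open>n\<close>.\<close>
  have "deficit_weight (1 - q) n n = deficit_weight q n n"
    by (simp add: deficit_weight_def mult.commute mult.left_commute)
  then show ?case
    using q step deficit_moment_0_Suc[of q n] deficit_moment_0_Suc[of "1 - q" n] by (simp add: algebra_simps)
qed

text \<open>Telescoping \<open>k * w k\<close> and \<open>k ^ 2 * w k\<close> and applying the ratio
  recursion to the shifted terms gives linear equations for the power sums \<open>S 1\<close> and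
  \<open>S 2\<close>; expanding the powers of \<open>n - k\<close> does the rest.\<close>

lemma deficit_moment_1:
  assumes "n \<ge> 1"
  shows "q * deficit_moment q 1 n =
    real n * (deficit_weight q n n - (1 - 2 * q) * deficit_moment q 0 n)"
  and "q\<^sup>2 * deficit_moment q 2 n =
    real n * ((real n * (1 - 2 * q)\<^sup>2 + (1 - q)) * deficit_moment q 0 n
      - (real n * (1 - 2 * q) + (1 - q)) * deficit_weight q n n)"
proof -
  define w where "w = deficit_weight q n"
  note rec = deficit_weight_Suc[OF assms, of _ q, folded w_def]
  define S where "S i = (\<Sum>k<n. real k ^ i * w k)" for i :: nat
  have "(\<Sum>k<n. real (Suc k) * w (Suc k)) - S 1 = real n * w n"
    using sum_lessThan_telescope[of "\<lambda>k. real k * w k" n] by (simp add: S_def sum_subtractf)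
  moreover have "(\<Sum>k<n. real (Suc k) * w (Suc k)) = (1 - q) * (real n * S 0 + S 1)"
    unfolding rec S_def sum_distrib_left sum.distrib[symmetric]
    by (intro sum.cong) (auto simp: algebra_simps)
  ultimately have S1: "q * S 1 = (1 - q) * real n * S 0 - real n * w n"
    by (simp add: algebra_simps)
  have "(\<Sum>k<n. real (Suc k) * (real (Suc k) * w (Suc k))) - S 2 = real n ^ 2 * w n"
    using sum_lessThan_telescope[of "\<lambda>k. real k ^ 2 * w k" n]
    by (simp add: S_def sum_subtractf power2_eq_square mult.assoc)
  moreover have "(\<Sum>k<n. real (Suc k) * (real (Suc k) * w (Suc k))) =
      (1 - q) * (S 2 + real (n + 1) * S 1 + real n * S 0)"
    unfolding rec S_def sum_distrib_left sum.distrib[symmetric]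
    by (intro sum.cong) (auto simp: algebra_simps power2_eq_square)
  ultimately have S2: "q * S 2 = (1 - q) * (real (n + 1) * S 1 + real n * S 0) - real n ^ 2 * w n"
    by (simp add: algebra_simps)
  have T0: "deficit_moment q 0 n = S 0"
    by (simp add: deficit_moment_def S_def w_def)
  have T1: "deficit_moment q 1 n = real n * S 0 - S 1"
    unfolding deficit_moment_def S_def sum_distrib_left sum_subtractf[symmetric]
    by (intro sum.cong) (auto simp: w_def of_nat_diff algebra_simps)
  have "deficit_moment q 2 n = (\<Sum>k<n. real n ^ 2 * w k - 2 * real n * (real k * w k) + real k ^ 2 * w k)"
    unfolding deficit_moment_def
    by (intro sum.cong) (auto simp: w_def of_nat_diff algebra_simps power2_eq_square)
  then have T2: "deficit_moment q 2 n = real n ^ 2 * S 0 - 2 * real n * S 1 + S 2"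
    by (simp add: S_def sum_subtractf sum.distrib sum_distrib_left)
  show "q * deficit_moment q 1 n =
    real n * (deficit_weight q n n - (1 - 2 * q) * deficit_moment q 0 n)"
    unfolding T0 T1 using S1 by (simp add: w_def algebra_simps)
  have "q\<^sup>2 * deficit_moment q 2 n =
      q\<^sup>2 * real n ^ 2 * S 0 - 2 * real n * q * (q * S 1) + q * (q * S 2)"
    unfolding T2 by (simp add: algebra_simps power2_eq_square)
  also have "q * (q * S 2) = (1 - q) * (real (n + 1) * (q * S 1) + real n * q * S 0) - q * real n ^ 2 * w n"
    unfolding S2 by (simp add: algebra_simps)
  finally show "q\<^sup>2 * deficit_moment q 2 n =
    real n * ((real n * (1 - 2 * q)\<^sup>2 + (1 - q)) * deficit_moment q 0 n
      - (real n * (1 - 2 * q) + (1 - q)) * deficit_weight q n n)"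
    unfolding T0 S1 by (simp add: w_def algebra_simps power2_eq_square)
qed

text \<open>By Chaundy-Bullard a Phase I win has probability \<open>deficit_moment q 0 n\<close>; by
  tilting, so has a win from behind. This is the factor 2. Phase I wins have duration 0 and
  contribute to no higher moment.\<close>

lemma duration_prob_sums:
  assumes q: "0 < q" "q < 1 / 2" and n: "n \<ge> 1"
  shows "duration_prob q n sums (2 * deficit_moment q 0 n)"
    and "(\<lambda>d. real d * duration_prob q n d) sums (deficit_moment q 1 n / (1 - 2 * q))"
    and "(\<lambda>d. real d ^ 2 * duration_prob q n d) sums
      (deficit_moment q 2 n / (1 - 2 * q) ^ 2 + 4 * q * (1 - q) * deficit_moment q 1 n / (1 - 2 * q) ^ 3)"
proof -
  define \<delta> where "\<delta> = 1 - 2 * q"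
  define P where "P = phase1_prob q n"
  define f where "f = first_passage q"
  define r where "r = q / (1 - q)"
  note fp = first_passage_sums[OF q, folded \<delta>_def f_def r_def]
  have dp: "duration_prob q n d = (if d = 0 then deficit_moment q 0 n else 0) + (\<Sum>m<n. P m * f (n - m) d)" for d
  proof -
    have "deficit_moment (1 - q) 0 n = (\<Sum>m<n. P m)"
      by (simp add: deficit_moment_def P_def phase1_prob_swap)
    then have "1 - (\<Sum>m<n. P m) = deficit_moment q 0 n"
      using deficit_moment_0_swap[of q n] q n by simp
    then show ?thesis using q by (simp add: duration_prob_eq P_def f_def)
  qed
  have tilt: "P m * r ^ (n - m) = deficit_weight q n m" if "m < n" for m
    using phase1_prob_tilt[of q m n] q that by (simp add: P_def r_def)
  have zero: "(\<lambda>d. if d = 0 then c else 0) sums c" for c :: real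
    using sums_single[of 0 "\<lambda>_. c"] by simp
  have "duration_prob q n sums (deficit_moment q 0 n + (\<Sum>m<n. P m * r ^ (n - m)))"
    unfolding dp by (intro sums_add zero sums_sum sums_mult fp)
  then show "duration_prob q n sums (2 * deficit_moment q 0 n)"
    by (simp add: tilt deficit_moment_def)
  have "(\<lambda>d. \<Sum>m<n. P m * (real d * f (n - m) d)) sums
      (\<Sum>m<n. P m * (real (n - m) / \<delta> * r ^ (n - m)))"
    by (intro sums_sum sums_mult fp)
  moreover have "real d * duration_prob q n d = (\<Sum>m<n. P m * (real d * f (n - m) d))" for d
    by (simp add: dp sum_distrib_left algebra_simps)
  moreover have "(\<Sum>m<n. P m * (real (n - m) / \<delta> * r ^ (n - m))) = deficit_moment q 1 n / \<delta>"
    unfolding deficit_moment_def sum_divide_distrib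
    by (intro sum.cong refl) (simp add: tilt[symmetric])
  ultimately show "(\<lambda>d. real d * duration_prob q n d) sums (deficit_moment q 1 n / (1 - 2 * q))"
    by (simp add: \<delta>_def)
  have "(\<lambda>d. \<Sum>m<n. P m * (real d ^ 2 * f (n - m) d)) sums
      (\<Sum>m<n. P m * ((real (n - m) ^ 2 / \<delta> ^ 2 + 4 * q * (1 - q) * real (n - m) / \<delta> ^ 3) * r ^ (n - m)))"
    by (intro sums_sum sums_mult fp)
  moreover have "real d ^ 2 * duration_prob q n d = (\<Sum>m<n. P m * (real d ^ 2 * f (n - m) d))" for d
    by (simp add: dp sum_distrib_left algebra_simps)
  moreover have "(\<Sum>m<n. P m * ((real (n - m) ^ 2 / \<delta> ^ 2 + 4 * q * (1 - q) * real (n - m) / \<delta> ^ 3) * r ^ (n - m)))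
      = deficit_moment q 2 n / \<delta> ^ 2 + 4 * q * (1 - q) * deficit_moment q 1 n / \<delta> ^ 3"
    unfolding deficit_moment_def sum_divide_distrib sum_distrib_left sum.distrib[symmetric]
    by (intro sum.cong refl) (simp add: tilt[symmetric] algebra_simps)
  ultimately show "(\<lambda>d. real d ^ 2 * duration_prob q n d) sums
      (deficit_moment q 2 n / (1 - 2 * q) ^ 2 + 4 * q * (1 - q) * deficit_moment q 1 n / (1 - 2 * q) ^ 3)"
    by (simp add: \<delta>_def)
qed

section \<open>The tail ratio and the exact formula for the variance\<close>

lemma deficit_weight_pos: "0 < q \<Longrightarrow> q < 1 \<Longrightarrow> n \<ge> 1 \<Longrightarrow> k \<le> n \<Longrightarrow> 0 < deficit_weight q n k"
  by (simp add: deficit_weight_def)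

lemma deficit_moment_0_pos:
  assumes "0 < q" "q < 1" "n \<ge> 1"
  shows "0 < deficit_moment q 0 n"
  unfolding deficit_moment_def using assms by (intro sum_pos) (auto simp: deficit_weight_pos lessThan_empty_iff)

text \<open>The factor \<open>1 - 2 * q\<close> normalizes the inhomogeneous term of the recursion
  to 1.\<close>

definition tail_ratio :: "real \<Rightarrow> nat \<Rightarrow> real" where
  "tail_ratio q n = deficit_moment q 0 n / ((1 - 2 * q) * deficit_weight q n n)"

lemma tail_ratio_Suc:
  assumes q: "0 < q" "q < 1 / 2" and n: "n \<ge> 1"
  shows "tail_ratio q n =
    1 + 2 * q * (1 - q) * (2 * real n + 1) / (real n + 1) * tail_ratio q (Suc n)"
proof -
  define t where "t = 2 * q * (1 - q) * (2 * real n + 1) / (real n + 1)"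
  let ?w = "deficit_weight q"
  have binom: "real (Suc n) * real (Suc n + Suc n - 1 choose Suc n) = 2 * (2 * real n + 1) * real (n + n - 1 choose n)"
  proof -
    have "Suc n * (Suc (n + n) choose Suc n) = Suc (n + n) * (n + n choose n)"
      using Suc_times_binomial_eq[of "n + n" n] by (simp only: mult.commute)
    moreover have "n + n choose n = 2 * (n + n - 1 choose n)"
      using central_binomial_half[OF n] by simp
    moreover have "Suc n + Suc n - 1 = Suc (n + n)" by simp
    ultimately have "Suc n * (Suc n + Suc n - 1 choose Suc n) = Suc (n + n) * (2 * (n + n - 1 choose n))"
      by simp
    from arg_cong[OF this, of real] show ?thesis
      by (simp only: of_nat_mult of_nat_Suc of_nat_add of_nat_numeral) (simp add: algebra_simps)
  qed
  have "real (Suc n) * ?w (Suc n) (Suc n) = 2 * (2 * real n + 1) * (q * (1 - q)) * ?w n n"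
    using arg_cong[OF binom, of "\<lambda>x. x * (q ^ Suc n * (1 - q) ^ Suc n)"]
    by (simp add: deficit_weight_def mult.assoc mult.left_commute mult.commute)
  then have w: "?w (Suc n) (Suc n) = t * ?w n n"
    by (simp add: t_def field_simps)
  define \<delta> where "\<delta> = 1 - 2 * q"
  have pos: "0 < t" "0 < ?w n n" "0 < \<delta>"
    using q n by (auto simp: t_def deficit_weight_pos \<delta>_def)
  have "deficit_moment q 0 n = deficit_moment q 0 (Suc n) + \<delta> * ?w n n"
    unfolding \<delta>_def using q by (intro deficit_moment_0_Suc n) auto
  then show ?thesis
    unfolding tail_ratio_def t_def[symmetric] w \<delta>_def[symmetric] using pos by (simp add: field_simps)
qed

text \<open>The lower bound is the recursion with its nonnegative last term dropped; the upper bound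
  says that the first deficit moment is nonnegative.\<close>

lemma tail_ratio_bounds:
  assumes q: "0 < q" "q < 1 / 2" and n: "n \<ge> 1"
  shows "1 \<le> tail_ratio q n" and "tail_ratio q n \<le> 1 / (1 - 2 * q) ^ 2"
proof -
  have pos: "0 < deficit_weight q n n" "0 < 1 - 2 * q"
    using q n by (auto simp: deficit_weight_pos)
  have "0 \<le> tail_ratio q (Suc n)"
    using q unfolding tail_ratio_def
    by (intro divide_nonneg_nonneg mult_nonneg_nonneg less_imp_le[OF deficit_moment_0_pos]
          less_imp_le[OF deficit_weight_pos]) auto
  then show "1 \<le> tail_ratio q n" using q by (subst tail_ratio_Suc[OF q n]) simp
  have "0 \<le> q * deficit_moment q 1 n"
    unfolding deficit_moment_def using q
    by (intro mult_nonneg_nonneg sum_nonneg) (auto simp: deficit_weight_def)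
  then have "(1 - 2 * q) * deficit_moment q 0 n \<le> deficit_weight q n n"
    unfolding deficit_moment_1(1)[OF n] using n by (simp add: zero_le_mult_iff)
  then show "tail_ratio q n \<le> 1 / (1 - 2 * q) ^ 2"
    using pos by (simp add: tail_ratio_def power2_eq_square divide_simps) (simp add: mult_ac)
qed

text \<open>\<open>s\<close> and \<open>s'\<close> remove the first two terms of the expansion of
  \<open>1 / tail_ratio q n\<close> before each multiplication by \<open>n\<close>, so that both
  stay bounded and no large terms cancel in the formula.\<close>

lemma phase2_variance_tail_ratio:
  fixes q :: real
  defines "\<delta> \<equiv> 1 - 2 * q" and "p \<equiv> 1 - q"
  assumes q: "0 < q" "q < 1 / 2" and n: "n \<ge> 1"
  defines "s \<equiv> real n * (1 / tail_ratio q n - \<delta>\<^sup>2)"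
  defines "s' \<equiv> real n * (s - 2 * p * q)"
  shows "phase2_variance q n =
    ((- s' - p * s / \<delta>) / (q\<^sup>2 * \<delta>\<^sup>2) + 4 * p * s / \<delta> ^ 4) / 2 - s\<^sup>2 / (4 * \<delta> ^ 4 * q\<^sup>2)"
proof -
  define T0 where "T0 = deficit_moment q 0 n"
  define T1 where "T1 = deficit_moment q 1 n"
  define T2 where "T2 = deficit_moment q 2 n"
  define a where "a = deficit_weight q n n"
  have pos: "0 < T0" "0 < \<delta>" "0 < a"
    using q n by (auto simp: T0_def \<delta>_def a_def deficit_moment_0_pos deficit_weight_pos)
  define u where "u = 1 / tail_ratio q n"
  \<comment> \<open>Eliminates the boundary weight, so that \<open>T0\<close> cancels from all
    normalized moments.\<close>
  have a: "a = u * T0 / \<delta>"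
    using pos by (simp add: u_def tail_ratio_def T0_def[symmetric] a_def[symmetric] \<delta>_def[symmetric])
  have s: "s = real n * (u - \<delta>\<^sup>2)" by (simp add: s_def u_def)
  have p: "p = 1 - q" and \<delta>: "\<delta> = 1 - 2 * q" by (simp_all add: p_def \<delta>_def)
  have T1: "T1 / T0 = s / (\<delta> * q)"
    using deficit_moment_1(1)[OF n, of q, folded T0_def T1_def a_def \<delta>_def] pos q
    unfolding a s by (simp add: field_simps power2_eq_square)
  have "q\<^sup>2 * T2 = T0 * (- s' - p * s / \<delta>)"
    using deficit_moment_1(2)[OF n, of q, folded T0_def T2_def a_def \<delta>_def p_def] pos q
    unfolding a s s'_def by (simp add: field_simps power2_eq_square p \<delta>)
  then have T2: "T2 / T0 = (- s' - p * s / \<delta>) / q\<^sup>2"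
    using pos q by (simp add: field_simps)
  have "phase2_variance q n =
      (T2 / \<delta>\<^sup>2 + 4 * q * p * T1 / \<delta> ^ 3) / (2 * T0) - (T1 / \<delta> / (2 * T0))\<^sup>2"
    using phase2_variance_eq[OF duration_prob_sums(1)[OF q n] _ duration_prob_sums(2,3)[OF q n]] pos
    by (simp add: T0_def T1_def T2_def \<delta>_def p_def)
  also have "\<dots> = (T2 / T0 / \<delta>\<^sup>2 + 4 * q * p * (T1 / T0) / \<delta> ^ 3) / 2 - (T1 / T0)\<^sup>2 / (4 * \<delta>\<^sup>2)"
    using pos by (simp add: field_simps power2_eq_square)
  also have "\<dots> = ((- s' - p * s / \<delta>) / (q\<^sup>2 * \<delta>\<^sup>2) + 4 * p * s / \<delta> ^ 4) / 2 - s\<^sup>2 / (4 * \<delta> ^ 4 * q\<^sup>2)"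
    unfolding T1 T2 using pos q by (simp add: divide_simps) (simp add: eval_nat_numeral algebra_simps)
  finally show ?thesis .
qed

section \<open>Asymptotic expansion\<close>

lemma poly_inverse_nat_tendsto:
  fixes p :: "real poly"
  shows "(\<lambda>n. poly p (1 / real n)) \<longlonglongrightarrow> poly p 0"
  by (intro isCont_tendsto_compose[where g = "poly p"] lim_1_over_n) (simp add: poly_isCont)

lemma tendsto_imp_bigo_1: "f \<longlonglongrightarrow> c \<Longrightarrow> f \<in> O(\<lambda>_. 1 :: real)" for f :: "nat \<Rightarrow> real"
  by (rule bigoI_tendsto[where c = c]) simp_all

lemma poly_inverse_nat_bigo:
  fixes p :: "real poly"
  assumes "\<forall>k<m. coeff p k = 0"
  shows "(\<lambda>n. poly p (1 / real n)) \<in> O(\<lambda>n. 1 / real n ^ m)"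
proof -
  obtain r where r: "p = monom 1 m * r"
    using assms monom_1_dvd_iff' by (metis dvdE)
  have "(\<lambda>n. poly r (1 / real n)) \<in> O(\<lambda>_. 1)"
    by (rule tendsto_imp_bigo_1[OF poly_inverse_nat_tendsto])
  from landau_o.big.mult_left[OF this, of "\<lambda>n. 1 / real n ^ m"]
  show ?thesis by (simp add: r poly_monom power_divide)
qed

text \<open>Iterating \<open>k\<close> steps forward leaves \<open>x ^ k * B\<close> plus a
  geometric series of residuals, all of them at most \<open>C / n ^ m\<close> since the bound
  decreases in \<open>n\<close>. Letting \<open>k\<close> grow at fixed \<open>n\<close> removes the
  first term.\<close>

lemma contraction_bigo:
  fixes e \<rho> :: "nat \<Rightarrow> real"
  assumes x: "0 \<le> x" "x < 1"
    and rec: "eventually (\<lambda>n. \<bar>e n\<bar> \<le> x * \<bar>e (Suc n)\<bar> + \<bar>\<rho> n\<bar>) sequentially"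
    and B: "eventually (\<lambda>n. \<bar>e n\<bar> \<le> B) sequentially"
    and \<rho>: "\<rho> \<in> O(\<lambda>n. 1 / real n ^ m)"
  shows "e \<in> O(\<lambda>n. 1 / real n ^ m)"
proof -
  obtain C where C: "C > 0" "eventually (\<lambda>n. norm (\<rho> n) \<le> C * norm (1 / real n ^ m)) sequentially"
    using \<rho> by (elim landau_o.bigE)
  obtain N where N: "\<And>n. n \<ge> N \<Longrightarrow> \<bar>e n\<bar> \<le> x * \<bar>e (Suc n)\<bar> + \<bar>\<rho> n\<bar>"
    "\<And>n. n \<ge> N \<Longrightarrow> \<bar>e n\<bar> \<le> B" "\<And>n. n \<ge> N \<Longrightarrow> \<bar>\<rho> n\<bar> \<le> C / real n ^ m" "N \<ge> 1"
    using eventually_conj[OF rec eventually_conj[OF B eventually_conj[OF C(2) eventually_ge_at_top[of 1]]]]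
    by (auto simp: eventually_sequentially)
  have bound: "\<bar>e n\<bar> \<le> x ^ k * B + C / (1 - x) / real n ^ m" if "n \<ge> N" for n k
    using that
  proof (induction k arbitrary: n)
    case 0
    then show ?case using N(2)[of n] C x by (simp add: add_increasing2)
  next
    case (Suc k)
    define c where "c = C / real n ^ m"
    have n: "n \<ge> 1" using Suc N by simp
    have "C / (1 - x) / real (Suc n) ^ m \<le> C / (1 - x) / real n ^ m"
      using C x n by (intro divide_left_mono power_mono) auto
    then have "\<bar>e (Suc n)\<bar> \<le> x ^ k * B + c / (1 - x)"
      using Suc.IH[of "Suc n"] Suc.prems by (simp add: c_def mult.commute)
    then have "x * \<bar>e (Suc n)\<bar> \<le> x * (x ^ k * B + c / (1 - x))"
      using x by (intro mult_left_mono) auto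
    then have "\<bar>e n\<bar> \<le> x * (x ^ k * B + c / (1 - x)) + c"
      using N(1)[OF Suc.prems] N(3)[OF Suc.prems] by (simp add: c_def)
    also have "\<dots> = x ^ Suc k * B + c / (1 - x)"
      using x by (simp add: field_simps)
    finally show ?case by (simp add: c_def mult.commute)
  qed
  have "\<bar>e n\<bar> \<le> C / (1 - x) * (1 / real n ^ m)" if "n \<ge> N" for n
  proof (rule LIMSEQ_le_const[of "\<lambda>k. x ^ k * B + C / (1 - x) / real n ^ m"])
    have "(\<lambda>k. x ^ k * B + C / (1 - x) / real n ^ m) \<longlonglongrightarrow> 0 * B + C / (1 - x) / real n ^ m"
      using x by (intro tendsto_intros LIMSEQ_power_zero) auto
    then show "(\<lambda>k. x ^ k * B + C / (1 - x) / real n ^ m) \<longlonglongrightarrow> C / (1 - x) * (1 / real n ^ m)"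
      by simp
  qed (use bound[OF that] in auto)
  then show ?thesis
    by (intro bigoI[of _ "C / (1 - x)"] eventually_sequentiallyI[of N]) auto
qed

section \<open>The formal expansion of the inverse tail ratio and its justification\<close>

text \<open>
  For \<open>b = \<delta>\<^sup>2\<close>, the polynomial \<open>ratio_poly b\<close> in \<open>1 / n\<close> is the formal expansion of \<open>1 / R n\<close>:
  its coefficients solve the recursion for \<open>R\<close> order by order. The scaling removes all denominators.
\<close>

definition scaled_ratio_poly :: "real \<Rightarrow> real poly" where
  "scaled_ratio_poly b = [:32 * b ^ 6, 16 * b ^ 5 - 16 * b ^ 6, 16 * b ^ 5 - 16 * b ^ 4,
     40 * b ^ 3 - 64 * b ^ 4 + 24 * b ^ 5,
     - 148 * b ^ 2 + 316 * b ^ 3 - 204 * b ^ 4 + 36 * b ^ 5,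
     706 * b - 1876 * b ^ 2 + 1704 * b ^ 3 - 588 * b ^ 4 + 54 * b ^ 5,
     - 4081 + 12949 * b - 15114 * b ^ 2 + 7770 * b ^ 3 - 1605 * b ^ 4 + 81 * b ^ 5:]"

definition ratio_poly :: "real \<Rightarrow> real poly" where
  "ratio_poly b = smult (1 / (32 * b ^ 5)) (scaled_ratio_poly b)"

text \<open>\<open>(1 + y) ^ 6 * p (y / (1 + y))\<close> as a polynomial in \<open>y\<close>, for \<open>p\<close> of degree at most 6\<close>

definition shift_poly :: "real poly \<Rightarrow> real poly" where
  "shift_poly p = (\<Sum>k\<le>6. smult (coeff p k) (monom 1 k * [:1, 1:] ^ (6 - k)))"

lemma poly_shift_poly:
  assumes "degree p \<le> 6" "y \<noteq> - 1"
  shows "poly (shift_poly p) y = (1 + y) ^ 6 * poly p (y / (1 + y))"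
proof -
  have "poly p z = (\<Sum>k\<le>6. coeff p k * z ^ k)" for z
    using arg_cong[OF poly_as_sum_of_monoms'[OF assms(1)], of "\<lambda>p. poly p z"]
    by (simp add: poly_sum poly_monom)
  moreover have "(1 + y) ^ 6 * (y / (1 + y)) ^ k = y ^ k * (1 + y) ^ (6 - k)" if "k \<le> 6" for k
  proof -
    have "(1 + y) ^ 6 = (1 + y) ^ k * (1 + y) ^ (6 - k)"
      using that by (simp flip: power_add)
    then show ?thesis using assms(2) by (simp add: power_divide add_eq_0_iff)
  qed
  ultimately show ?thesis
    unfolding shift_poly_def poly_sum
    by (simp add: poly_monom sum_distrib_left mult.left_commute[of "(1 + y) ^ 6"])
qed

lemma shift_poly_coeffs:
  "shift_poly [:h0, h1, h2, h3, h4, h5, h6:] =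
    [:h0, 6 * h0 + h1, 15 * h0 + 5 * h1 + h2, 20 * h0 + 10 * h1 + 4 * h2 + h3,
      15 * h0 + 10 * h1 + 6 * h2 + 3 * h3 + h4, 6 * h0 + 5 * h1 + 4 * h2 + 3 * h3 + 2 * h4 + h5,
      h0 + h1 + h2 + h3 + h4 + h5 + h6:]"
  by (simp add: shift_poly_def eval_nat_numeral monom_Suc monom_0 one_pCons algebra_simps)

text \<open>
  With \<open>h n\<close> for the value of \<open>ratio_poly b\<close> at \<open>y = 1 / n\<close>, this is
  \<open>(1 + y) ^ 7 * (h (n + 1) - h n * h (n + 1) - t n * h n)\<close>, the recursion for \<open>R = 1 / h\<close> cleared of
  denominators.
\<close>

definition residual_poly :: "real \<Rightarrow> real poly" where
  "residual_poly b =
     [:1, 1:] * shift_poly (ratio_poly b) * (1 - ratio_poly b)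
     - smult (1 - b) ([:1, 1 / 2:] * [:1, 1:] ^ 6 * ratio_poly b)"

lemma binomial_6: "[:1, 1:] ^ 6 = [:1, 6, 15, 20, 15, 6, 1 :: real:]"
  by (simp add: eval_nat_numeral one_pCons)

lemma shift_poly_smult: "shift_poly (smult a p) = smult a (shift_poly p)"
  by (rule poly_eqI) (simp add: shift_poly_def coeff_sum sum_distrib_left mult.assoc)

text \<open>The residual is quadratic in \<open>ratio_poly\<close>, so multiplying it by the square
  of \<open>c = 32 * b ^ 5\<close> clears denominators; each coefficient is then a polynomial
  identity in \<open>b\<close>.\<close>

lemma coeff_residual_poly:
  assumes "b \<noteq> 0"
  shows "\<forall>k<7. coeff (residual_poly b) k = 0"
proof -
  define c where "c = 32 * b ^ 5"
  define N where "N = scaled_ratio_poly b"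
  define P where "P = [:1, 1:] * shift_poly N * ([:c:] - N)
    - smult (c * (1 - b)) ([:1, 1 / 2:] * [:1, 6, 15, 20, 15, 6, 1:] * N)"
  have N: "N = smult c (ratio_poly b)"
    using assms by (simp add: N_def c_def ratio_poly_def)
  have c: "[:c:] = smult c 1" by simp
  have "U * smult c S * (smult c 1 - smult c r) - smult (c * (1 - b)) (W * smult c r) =
      smult c (smult c (U * S * (1 - r) - smult (1 - b) (W * r)))" for U S W r :: "real poly"
    by (simp add: smult_diff_right right_diff_distrib mult_ac)
  then have "P = smult c (smult c (residual_poly b))"
    unfolding P_def residual_poly_def binomial_6 N c shift_poly_smult .
  then have coeff: "coeff P k = c * (c * coeff (residual_poly b) k)" for k
    by simp
  have "coeff P 0 = 0" "coeff P 1 = 0" "coeff P 2 = 0" "coeff P 3 = 0" "coeff P 4 = 0"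
    "coeff P 5 = 0" "coeff P 6 = 0"
    unfolding P_def N_def c_def scaled_ratio_poly_def shift_poly_coeffs
    by (simp_all add: eval_nat_numeral) (simp_all add: field_simps)
  moreover have "k = 0 \<or> k = 1 \<or> k = 2 \<or> k = 3 \<or> k = 4 \<or> k = 5 \<or> k = 6" if "k < 7" for k :: nat
    using that by presburger
  ultimately have "coeff P k = 0" if "k < 7" for k using that by metis
  then show ?thesis using assms unfolding coeff by (simp add: c_def)
qed

text \<open>The error \<open>e\<close> against \<open>1 / h\<close> obeys the recursion of
  \<open>R\<close> with 1 replaced by a residual of order \<open>1 / n ^ 7\<close>, so
  \<open>contraction_bigo\<close> applies to it.\<close>

lemma ratio_expansion:
  assumes b: "0 < b" "b < 1"
    and rec: "\<And>n. n \<ge> 1 \<Longrightarrow> R n = 1 + (1 - b) * (2 * real n + 1) / (2 * (real n + 1)) * R (Suc n)"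
    and R: "\<And>n. n \<ge> 1 \<Longrightarrow> 1 \<le> R n" "\<And>n. n \<ge> 1 \<Longrightarrow> R n \<le> B"
  shows "(\<lambda>n. 1 / R n - poly (ratio_poly b) (1 / real n)) \<in> O(\<lambda>n. 1 / real n ^ 7)"
proof -
  define H where "H = ratio_poly b"
  define h where "h n = poly H (1 / real n)" for n
  define t where "t n = (1 - b) * (2 * real n + 1) / (2 * (real n + 1))" for n
  \<comment> \<open>The residual polynomial divided by the cleared denominators, signed so that
    \<open>e n = t n * e (Suc n) + \<rho> n\<close>.\<close>
  define \<rho> where
    "\<rho> n = poly (residual_poly b) (1 / real n) * (- 1 / ((1 + 1 / real n) ^ 7 * h n * h (Suc n)))" for n
  define e where "e n = R n - 1 / h n" for n
  have "poly H 0 = b" using b by (simp add: H_def ratio_poly_def scaled_ratio_poly_def eval_nat_numeral)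
  then have h_lim: "h \<longlonglongrightarrow> b"
    using poly_inverse_nat_tendsto[of H] by (simp add: h_def[abs_def])
  then have h_lim': "(\<lambda>n. h (Suc n)) \<longlonglongrightarrow> b" by (rule LIMSEQ_Suc)
  have h_ge: "eventually (\<lambda>n. h n \<ge> b / 2 \<and> h (Suc n) \<ge> b / 2 \<and> n \<ge> 1) sequentially"
  proof -
    have "eventually (\<lambda>n. h n > b / 2) sequentially" "eventually (\<lambda>n. h (Suc n) > b / 2) sequentially"
      using b by (auto intro!: order_tendstoD(1)[OF h_lim] order_tendstoD(1)[OF h_lim']
          simp del: less_divide_eq_numeral1 divide_less_eq_numeral1)
    then show ?thesis using eventually_ge_at_top[of 1] by eventually_elim auto
  qed
  have "(\<lambda>n. - 1 / ((1 + 1 / real n) ^ 7 * h n * h (Suc n))) \<longlonglongrightarrow> - 1 / ((1 + 0) ^ 7 * b * b)"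
    using b by (intro tendsto_intros h_lim h_lim' lim_1_over_n) auto
  from landau_o.big.mult[OF poly_inverse_nat_bigo[OF coeff_residual_poly[of b]] tendsto_imp_bigo_1[OF this]]
  have \<rho>_bigo: "\<rho> \<in> O(\<lambda>n. 1 / real n ^ 7)"
    using b by (simp add: \<rho>_def[abs_def])
  have t_bound: "0 \<le> t n" "t n \<le> 1 - b" for n
  proof -
    define r where "r = (2 * real n + 1) / (2 * (real n + 1))"
    have "0 \<le> r" "r \<le> 1" by (auto simp: r_def)
    moreover have "t n = (1 - b) * r" by (simp add: t_def r_def)
    ultimately show "0 \<le> t n" "t n \<le> 1 - b"
      using b by (auto intro: mult_left_le)
  qed
  have "e \<in> O(\<lambda>n. 1 / real n ^ 7)"
  proof (rule contraction_bigo[OF _ _ _ _ \<rho>_bigo])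
    show "0 \<le> 1 - b" "1 - b < 1" using b by auto
    show "eventually (\<lambda>n. \<bar>e n\<bar> \<le> (1 - b) * \<bar>e (Suc n)\<bar> + \<bar>\<rho> n\<bar>) sequentially"
      using h_ge
    proof eventually_elim
      case (elim n)
      define y where "y = 1 / real n"
      have y: "y > 0" using elim by (simp add: y_def)
      \<comment> \<open>This is where the factor \<open>[:1, 1 / 2:]\<close> of
        \<open>residual_poly\<close> comes from.\<close>
      have t: "t n * (1 + y) = (1 - b) * (1 + y / 2)"
      proof -
        have n: "real n \<noteq> 0" "real n + 1 \<noteq> 0" using elim by auto
        then have "1 + y = (real n + 1) / real n" "1 + y / 2 = (2 * real n + 1) / (2 * real n)"
          by (simp_all add: y_def field_simps)
        then show ?thesis using n by (simp only: t_def) (simp add: divide_simps)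
      qed
      have "degree H \<le> 6"
        by (simp add: H_def ratio_poly_def scaled_ratio_poly_def)
      moreover have "1 / real (Suc n) = y / (1 + y)"
        using elim by (simp add: y_def field_simps)
      ultimately have S: "poly (shift_poly H) y = (1 + y) ^ 6 * h (Suc n)"
        using y by (simp add: poly_shift_poly h_def)
      have "poly (residual_poly b) y =
          (1 + y) ^ 7 * (h (Suc n) * (1 - h n) - t n * h n)"
      proof -
        define z where "z = (1 + y) ^ 6"
        have "poly (residual_poly b) y =
            (1 + y) * (z * h (Suc n)) * (1 - h n) - z * h n * ((1 - b) * (1 + y / 2))"
        proof -
          have 1: "poly [:1, 1:] y = 1 + y" "poly [:1, 1 / 2:] y = 1 + y / 2" "poly ([:1, 1:] ^ 6) y = z"
            by (simp_all add: z_def)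
          have 2: "poly H y = h n" "poly (shift_poly H) y = z * h (Suc n)"
            using S by (simp_all add: h_def y_def z_def)
          show ?thesis
            unfolding residual_poly_def H_def[symmetric] poly_diff poly_mult poly_smult poly_1 1 2
            by (simp only: mult_ac)
        qed
        also have "\<dots> = (1 + y) * z * (h (Suc n) * (1 - h n) - t n * h n)"
          unfolding t[symmetric] by (simp only: right_diff_distrib mult_ac)
        also have "(1 + y) * z = (1 + y) ^ 7"
          by (simp add: z_def flip: power_Suc)
        finally show ?thesis .
      qed
      then have "\<rho> n = - ((h (Suc n) * (1 - h n) - t n * h n) / (h n * h (Suc n)))"
        using y unfolding \<rho>_def y_def[symmetric] by (simp add: mult.assoc)
      also have "\<dots> = 1 + t n / h (Suc n) - 1 / h n"
      proof -
        have "h n \<noteq> 0" "h (Suc n) \<noteq> 0" using elim b by auto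
        then show ?thesis by (simp add: field_simps)
      qed
      finally have \<rho>: "\<rho> n = 1 + t n / h (Suc n) - 1 / h n" .
      have "e n = t n * e (Suc n) + \<rho> n"
      proof -
        have "R n = 1 + t n * R (Suc n)" using rec[of n] elim unfolding t_def by simp
        then show ?thesis unfolding e_def \<rho> by (simp add: right_diff_distrib)
      qed
      then have "\<bar>e n\<bar> \<le> t n * \<bar>e (Suc n)\<bar> + \<bar>\<rho> n\<bar>"
        using t_bound[of n] by (metis abs_mult abs_of_nonneg abs_triangle_ineq)
      also have "t n * \<bar>e (Suc n)\<bar> \<le> (1 - b) * \<bar>e (Suc n)\<bar>"
        using t_bound[of n] by (intro mult_right_mono) auto
      finally show ?case by simp
    qed
    show "eventually (\<lambda>n. \<bar>e n\<bar> \<le> B + 2 / b) sequentially"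
      using h_ge
    proof eventually_elim
      case (elim n)
      have "1 / h n \<le> 1 / (b / 2)"
        using elim b by (intro divide_left_mono) auto
      moreover have "0 < 1 / h n"
        using elim b by auto
      moreover have "1 \<le> R n" "R n \<le> B" using R elim by auto
      ultimately have "R n - 1 / h n \<le> B + 2 / b" "- (R n - 1 / h n) \<le> B + 2 / b"
        unfolding divide_divide_eq_right by linarith+
      then show ?case unfolding e_def by (rule abs_leI)
    qed
  qed
  moreover have "(\<lambda>n. h n / R n) \<in> O(\<lambda>_. 1)"
  proof -
    have "(\<lambda>n. 1 / R n) \<in> O(\<lambda>_. 1)"
    proof (rule bigoI[of _ 1], rule eventually_sequentiallyI[of 1])
      fix n :: nat assume "1 \<le> n"
      then have "1 \<le> R n" by (rule R)
      then show "norm (1 / R n) \<le> 1 * norm (1 :: real)" by simp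
    qed
    from landau_o.big.mult[OF tendsto_imp_bigo_1[OF h_lim] this] show ?thesis by simp
  qed
  ultimately have "(\<lambda>n. e n * (h n / R n)) \<in> O(\<lambda>n. 1 / real n ^ 7 * 1)"
    by (rule landau_o.big.mult)
  \<comment> \<open>Returns from \<open>R\<close> to its inverse by
    \<open>1 / R n - h n = - e n * h n / R n\<close>; the last factor is bounded because
    \<open>R n \<ge> 1\<close>.\<close>
  then have "(\<lambda>n. - (e n * (h n / R n))) \<in> O(\<lambda>n. 1 / real n ^ 7)"
    by simp
  moreover have "eventually (\<lambda>n. - (e n * (h n / R n)) = 1 / R n - h n) sequentially"
    using h_ge
  proof eventually_elim
    case (elim n)
    then have "h n \<noteq> 0" "R n \<noteq> 0" using R(1)[of n] b by auto
    then show ?case by (simp add: e_def field_simps)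
  qed
  ultimately have "(\<lambda>n. 1 / R n - h n) \<in> O(\<lambda>n. 1 / real n ^ 7)"
    by (rule landau_o.big.in_cong[THEN iffD1, rotated])
  then show ?thesis by (simp add: h_def H_def)
qed

section \<open>From the inverse tail ratio to the variance\<close>

definition drop_coeff :: "real poly \<Rightarrow> real poly" where
  "drop_coeff p = poly_shift 1 p"

lemma drop_coeff_pCons [simp]: "drop_coeff (pCons a p) = p"
  by (rule poly_eqI) (simp add: drop_coeff_def coeff_poly_shift)

lemma poly_drop_coeff: "y \<noteq> 0 \<Longrightarrow> poly (drop_coeff p) y = (poly p y - coeff p 0) / y"
  by (cases p) simp

lemma ratio_poly_0: "b \<noteq> 0 \<Longrightarrow> coeff (ratio_poly b) 0 = b"
  by (simp add: ratio_poly_def scaled_ratio_poly_def eval_nat_numeral)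

lemma ratio_poly_1: "b \<noteq> 0 \<Longrightarrow> coeff (ratio_poly b) 1 = (1 - b) / 2"
  by (simp add: ratio_poly_def scaled_ratio_poly_def eval_nat_numeral field_simps)

text \<open>\<open>drop_coeff\<close> does to expansions what subtracting the leading coefficient
  and multiplying by \<open>n\<close> does to sequences. Two such steps enlarge the error by
  \<open>n ^ 2\<close>, from \<open>1 / n ^ 7\<close> to \<open>1 / n ^ 5\<close>.\<close>

lemma quadratic_perturbation_bigo:
  fixes u :: "nat \<Rightarrow> real" and H :: "real poly"
  assumes u: "(\<lambda>n. u n - poly H (1 / real n)) \<in> O(\<lambda>n. 1 / real n ^ 7)"
  defines "s \<equiv> \<lambda>n. real n * (u n - coeff H 0)"
  defines "s' \<equiv> \<lambda>n. real n * (s n - coeff H 1)"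
  defines "S \<equiv> drop_coeff H" and "S' \<equiv> drop_coeff (drop_coeff H)"
  shows "(\<lambda>n. \<alpha> * s' n + \<beta> * s n + \<gamma> * s n ^ 2
    - poly (smult \<alpha> S' + smult \<beta> S + smult \<gamma> (S ^ 2)) (1 / real n)) \<in> O(\<lambda>n. 1 / real n ^ 5)"
proof -
  define \<epsilon> where "\<epsilon> n = u n - poly H (1 / real n)" for n
  define w where "w n = real n ^ 2 * \<epsilon> n" for n
  have "(\<lambda>n. real n ^ 2 * \<epsilon> n) \<in> O(\<lambda>n. real n ^ 2 * (1 / real n ^ 7))"
    using u by (intro landau_o.big.mult_left) (simp add: \<epsilon>_def[abs_def])
  \<comment> \<open>The equality includes \<open>n = 0\<close>, where both sides are 0 because
    division by zero gives 0.\<close>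
  also have "(\<lambda>n. real n ^ 2 * (1 / real n ^ 7)) = (\<lambda>n. 1 / real n ^ 5)"
    by (simp add: fun_eq_iff eval_nat_numeral)
  finally have w: "w \<in> O(\<lambda>n. 1 / real n ^ 5)" by (simp add: w_def[abs_def])
  have inverse_1: "(\<lambda>n. 1 / real n) \<in> O(\<lambda>_. 1)"
    by (rule tendsto_imp_bigo_1[OF lim_1_over_n])
  have "(\<lambda>n. 1 / real n ^ 5) \<in> O(\<lambda>_. 1)"
    using tendsto_imp_bigo_1[OF tendsto_power[OF lim_1_over_n, of 5]] by (simp add: power_divide)
  then have w_1: "w \<in> O(\<lambda>_. 1)" using w landau_o.big_trans by blast
  \<comment> \<open>The total error is exactly \<open>w n * f n\<close>, where \<open>w\<close> is
    the error of \<open>s'\<close> and \<open>w n / n\<close> that of \<open>s\<close>; it remains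
    to bound \<open>f\<close>.\<close>
  define f where "f n = \<alpha> + \<beta> * (1 / real n) + 2 * \<gamma> * (poly S (1 / real n) * (1 / real n))
    + \<gamma> * (w n * (1 / real n * (1 / real n)))" for n
  have prod_1: "(\<lambda>n. g n * h n) \<in> O(\<lambda>_. 1)" if "g \<in> O(\<lambda>_. 1)" "h \<in> O(\<lambda>_. 1)" for g h :: "nat \<Rightarrow> real"
    using landau_o.big.mult[OF that] by simp
  have const_1: "(\<lambda>_. c) \<in> O(\<lambda>_. 1)" for c :: real by simp
  have "f \<in> O(\<lambda>_. 1)"
    unfolding f_def[abs_def]
    by (intro sum_in_bigo(1) prod_1 inverse_1 w_1 const_1 tendsto_imp_bigo_1[OF poly_inverse_nat_tendsto])
  from landau_o.big.mult[OF w this]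
  have wf: "(\<lambda>n. w n * f n) \<in> O(\<lambda>n. 1 / real n ^ 5)" by simp
  have "eventually (\<lambda>n. w n * f n = \<alpha> * s' n + \<beta> * s n + \<gamma> * s n ^ 2
      - poly (smult \<alpha> S' + smult \<beta> S + smult \<gamma> (S ^ 2)) (1 / real n)) sequentially"
    using eventually_ge_at_top[of 1]
  proof eventually_elim
    case (elim n)
    define y where "y = 1 / real n"
    define A where "A = poly S y"
    define A' where "A' = poly S' y"
    have y: "y \<noteq> 0" "real n = 1 / y" using elim by (auto simp: y_def)
    have coeff_S: "coeff S 0 = coeff H 1"
      by (cases H) (simp add: S_def)
    have "poly H y = A * y + coeff H 0"
      unfolding A_def S_def by (simp add: poly_drop_coeff[OF y(1)] y(1))
    then have s: "s n = A + w n * y"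
      unfolding s_def w_def \<epsilon>_def y_def[symmetric] y(2) using y(1)
      by (simp add: power2_eq_square divide_simps)
    have "A' = (A - coeff H 1) / y"
      unfolding A'_def S'_def A_def using poly_drop_coeff[OF y(1), of S] coeff_S by (simp add: S_def)
    then have s': "s' n = A' + w n"
      unfolding s'_def s y(2) using y(1) by (simp add: field_simps)
    show ?case
      unfolding s s' f_def y_def[symmetric] by (simp add: A_def[symmetric] A'_def[symmetric] algebra_simps power2_eq_square)
  qed
  with wf show ?thesis
    by (rule landau_o.big.in_cong[THEN iffD1, rotated])
qed

text \<open>The formula of \<open>phase2_variance_tail_ratio\<close>, sorted by \<open>s'\<close>,
  \<open>s\<close> and \<open>s ^ 2\<close>, with the formal expansions in their place.\<close>

definition variance_poly :: "real \<Rightarrow> real poly" where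
  "variance_poly q = (let \<delta> = 1 - 2 * q; S = drop_coeff (ratio_poly (\<delta>\<^sup>2)) in
     smult (- 1 / (2 * q\<^sup>2 * \<delta>\<^sup>2)) (drop_coeff S)
     + smult (2 * (1 - q) / \<delta> ^ 4 - (1 - q) / (2 * q\<^sup>2 * \<delta> ^ 3)) S
     + smult (- 1 / (4 * \<delta> ^ 4 * q\<^sup>2)) (S ^ 2))"

definition variance_expansion_poly :: "real \<Rightarrow> real poly" where
  "variance_expansion_poly q =
    [:(q - 1) * (4 * q ^ 2 - 3 * q - 2) / (2 * q - 1) ^ 4,
      - ((q - 1) * (4 * q ^ 2 + 2 * q - 7) / (2 * q - 1) ^ 6),
      - ((q - 1) * (24 * q ^ 4 - 12 * q ^ 3 - 58 * q ^ 2 + 29 * q + 18) / (2 * q - 1) ^ 8),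
      - ((q - 1) * (144 * q ^ 6 - 216 * q ^ 5 - 348 * q ^ 4 + 444 * q ^ 3 + 328 * q ^ 2
           - 312 * q - 41) / (2 * q - 1) ^ 10),
      - ((q - 1) * (864 * q ^ 8 - 2160 * q ^ 7 - 1704 * q ^ 6 + 4956 * q ^ 5 + 4632 * q ^ 4
           - 9972 * q ^ 3 + 1586 * q ^ 2 + 1711 * q + 88) / (2 * q - 1) ^ 12):]"

section \<open>Comparison of the coefficients\<close>

lemma quadratic_expansion_coeffs:
  fixes \<alpha> \<beta> \<gamma> h1 h2 h3 h4 h5 h6 :: real
  defines "p \<equiv> smult \<alpha> [:h2, h3, h4, h5, h6:] + smult \<beta> [:h1, h2, h3, h4, h5, h6:]
    + smult \<gamma> ([:h1, h2, h3, h4, h5, h6:] ^ 2)"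
  shows "coeff p 0 = \<alpha> * h2 + \<beta> * h1 + \<gamma> * h1\<^sup>2"
    and "coeff p 1 = \<alpha> * h3 + \<beta> * h2 + \<gamma> * (2 * h1 * h2)"
    and "coeff p 2 = \<alpha> * h4 + \<beta> * h3 + \<gamma> * (2 * h1 * h3 + h2\<^sup>2)"
    and "coeff p 3 = \<alpha> * h5 + \<beta> * h4 + \<gamma> * (2 * h1 * h4 + 2 * h2 * h3)"
    and "coeff p 4 = \<alpha> * h6 + \<beta> * h5 + \<gamma> * (2 * h1 * h5 + 2 * h2 * h4 + h3\<^sup>2)"
  unfolding p_def by (simp_all add: eval_nat_numeral algebra_simps)

text \<open>A common denominator for generic numerators, so that the explicit ones are inserted only
  into polynomial identities.\<close>

lemma variance_coeff_numerators:
  fixes d r N1 N2 N3 N4 N5 N6 :: real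
  assumes "d \<noteq> 0" "r \<noteq> 0"
  defines "\<alpha> \<equiv> - 2 / (r\<^sup>2 * d\<^sup>2)"
    and "\<beta> \<equiv> (1 + d) / d ^ 4 - (1 + d) / (r\<^sup>2 * d ^ 3)"
    and "\<gamma> \<equiv> - 1 / (d ^ 4 * r\<^sup>2)"
  shows "\<alpha> * (N2 / d ^ 2) + \<beta> * N1 + \<gamma> * (N1\<^sup>2) =
      (- 2 * N2 + (1 + d) * (r\<^sup>2 - d) * N1 - (N1\<^sup>2)) / (r\<^sup>2 * d ^ 4)"
    and "\<alpha> * (N3 / d ^ 4) + \<beta> * (N2 / d ^ 2) + \<gamma> * (2 * N1 * (N2 / d ^ 2)) =
      (- 2 * N3 + (1 + d) * (r\<^sup>2 - d) * N2 - (2 * N1 * N2)) / (r\<^sup>2 * d ^ 6)"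
    and "\<alpha> * (N4 / d ^ 6) + \<beta> * (N3 / d ^ 4) + \<gamma> * (2 * N1 * (N3 / d ^ 4) + (N2 / d ^ 2)\<^sup>2) =
      (- 2 * N4 + (1 + d) * (r\<^sup>2 - d) * N3 - (2 * N1 * N3 + N2\<^sup>2)) / (r\<^sup>2 * d ^ 8)"
    and "\<alpha> * (N5 / d ^ 8) + \<beta> * (N4 / d ^ 6) + \<gamma> * (2 * N1 * (N4 / d ^ 6) + 2 * (N2 / d ^ 2) * (N3 / d ^ 4)) =
      (- 2 * N5 + (1 + d) * (r\<^sup>2 - d) * N4 - (2 * N1 * N4 + 2 * N2 * N3)) / (r\<^sup>2 * d ^ 10)"
    and "\<alpha> * (N6 / d ^ 10) + \<beta> * (N5 / d ^ 8) + \<gamma> * (2 * N1 * (N5 / d ^ 8)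
      + 2 * (N2 / d ^ 2) * (N4 / d ^ 6) + (N3 / d ^ 4)\<^sup>2) =
      (- 2 * N6 + (1 + d) * (r\<^sup>2 - d) * N5 - (2 * N1 * N5 + 2 * N2 * N4 + N3\<^sup>2)) / (r\<^sup>2 * d ^ 12)"
  using assms(1,2) unfolding \<alpha>_def \<beta>_def \<gamma>_def
  by (simp_all add: divide_simps) (simp_all add: eval_nat_numeral algebra_simps)

text \<open>For \<open>k\<close> from 1 to 6, coefficient \<open>k\<close> of
  \<open>ratio_poly b\<close> is this value divided by \<open>b ^ (k - 1)\<close>; the list index is
  shifted accordingly.\<close>

definition ratio_numerator :: "nat \<Rightarrow> real \<Rightarrow> real" where
  "ratio_numerator k b = [
     (1 - b) / 2,
     (b - 1) / 2,
     (5 - 8 * b + 3 * b ^ 2) / 4,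
     (- 37 + 79 * b - 51 * b ^ 2 + 9 * b ^ 3) / 8,
     (353 - 938 * b + 852 * b ^ 2 - 294 * b ^ 3 + 27 * b ^ 4) / 16,
     (- 4081 + 12949 * b - 15114 * b ^ 2 + 7770 * b ^ 3 - 1605 * b ^ 4 + 81 * b ^ 5) / 32] ! (k - 1)"

lemma ratio_poly_eq:
  assumes "d \<noteq> 0"
  shows "ratio_poly (d\<^sup>2) = [:d\<^sup>2, ratio_numerator 1 (d\<^sup>2),
    ratio_numerator 2 (d\<^sup>2) / d ^ 2, ratio_numerator 3 (d\<^sup>2) / d ^ 4,
    ratio_numerator 4 (d\<^sup>2) / d ^ 6, ratio_numerator 5 (d\<^sup>2) / d ^ 8,
    ratio_numerator 6 (d\<^sup>2) / d ^ 10:]"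
  using assms
  by (simp add: ratio_poly_def scaled_ratio_poly_def ratio_numerator_def divide_simps)
     (simp add: eval_nat_numeral algebra_simps)

lemma coeff_variance_poly:
  assumes "0 < q" "q < 1 / 2"
  shows "\<forall>k<5. coeff (variance_poly q - variance_expansion_poly q) k = 0"
proof -
  define d where "d = 1 - 2 * q"
  \<comment> \<open>Since \<open>2 * (1 - q) = 1 + d\<close>, using \<open>d\<close> and
    \<open>r\<close> absorbs the stray factors 2 of \<open>variance_poly\<close>.\<close>
  define r where "r = 2 * q"
  define N where "N k = ratio_numerator k (d\<^sup>2)" for k
  have d: "d \<noteq> 0" and r: "r \<noteq> 0" and dr: "d = 1 - r" and q: "q = r / 2"
    using assms by (auto simp: d_def r_def)
  have "variance_poly q = (let S = drop_coeff (ratio_poly (d\<^sup>2)) in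
     smult (- 2 / (r\<^sup>2 * d\<^sup>2)) (drop_coeff S)
     + smult ((1 + d) / d ^ 4 - (1 + d) / (r\<^sup>2 * d ^ 3)) S
     + smult (- 1 / (d ^ 4 * r\<^sup>2)) (S ^ 2))"
  proof -
    have "- 1 / (2 * q\<^sup>2 * d\<^sup>2) = - 2 / (r\<^sup>2 * d\<^sup>2)"
      "2 * (1 - q) / d ^ 4 - (1 - q) / (2 * q\<^sup>2 * d ^ 3) = (1 + d) / d ^ 4 - (1 + d) / (r\<^sup>2 * d ^ 3)"
      "- 1 / (4 * d ^ 4 * q\<^sup>2) = - 1 / (d ^ 4 * r\<^sup>2)"
      using r by (simp_all add: q dr power_divide add_divide_distrib diff_divide_distrib)
    then show ?thesis unfolding variance_poly_def d_def[symmetric] Let_def by (simp only:)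
  qed
  note coeffs = this[unfolded Let_def ratio_poly_eq[OF d] drop_coeff_pCons, folded N_def]
    quadratic_expansion_coeffs variance_coeff_numerators[OF d r]
  have "2 * q - 1 = - d" by (simp add: d_def)
  then have even: "(2 * q - 1) ^ 4 = d ^ 4" "(2 * q - 1) ^ 6 = d ^ 6" "(2 * q - 1) ^ 8 = d ^ 8"
    "(2 * q - 1) ^ 10 = d ^ 10" "(2 * q - 1) ^ 12 = d ^ 12"
    by simp_all
  \<comment> \<open>The \<open>q ^ 2\<close> in the denominators of \<open>variance_poly\<close> is
    absent from the expansion, so each numerator has to contain the factor \<open>r ^ 2\<close>;
    what remains is a polynomial identity in \<open>q\<close>.\<close>
  have cancel: "A / (r\<^sup>2 * D) - B / D = 0" if "A = r\<^sup>2 * B" for A B D :: real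
    using that r by simp
  have cancel': "A / (r\<^sup>2 * D) - (- (B / D)) = 0" if "A = r\<^sup>2 * - B" for A B D :: real
    using that r by simp
  have expansion:
    "coeff (variance_expansion_poly q) 0 = (q - 1) * (4 * q ^ 2 - 3 * q - 2) / d ^ 4"
    "coeff (variance_expansion_poly q) 1 = - ((q - 1) * (4 * q ^ 2 + 2 * q - 7) / d ^ 6)"
    "coeff (variance_expansion_poly q) 2 = - ((q - 1) * (24 * q ^ 4 - 12 * q ^ 3 - 58 * q ^ 2 + 29 * q + 18) / d ^ 8)"
    "coeff (variance_expansion_poly q) 3 = - ((q - 1) * (144 * q ^ 6 - 216 * q ^ 5 - 348 * q ^ 4 + 444 * q ^ 3 + 328 * q ^ 2
           - 312 * q - 41) / d ^ 10)"
    "coeff (variance_expansion_poly q) 4 = - ((q - 1) * (864 * q ^ 8 - 2160 * q ^ 7 - 1704 * q ^ 6 + 4956 * q ^ 5 + 4632 * q ^ 4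
           - 9972 * q ^ 3 + 1586 * q ^ 2 + 1711 * q + 88) / d ^ 12)"
    unfolding variance_expansion_poly_def even by (simp_all add: eval_nat_numeral)
  note N = N_def ratio_numerator_def d_def r_def
  have 0: "coeff (variance_poly q - variance_expansion_poly q) 0 = 0"
    unfolding coeff_diff expansion coeffs
    by (rule cancel) (simp add: N, algebra)
  have 1: "coeff (variance_poly q - variance_expansion_poly q) 1 = 0"
    unfolding coeff_diff expansion coeffs
    by (rule cancel') (simp add: N, algebra)
  have 2: "coeff (variance_poly q - variance_expansion_poly q) 2 = 0"
    unfolding coeff_diff expansion coeffs
    by (rule cancel') (simp add: N, algebra)
  have 3: "coeff (variance_poly q - variance_expansion_poly q) 3 = 0"
    unfolding coeff_diff expansion coeffs
    by (rule cancel') (simp add: N, algebra)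
  have 4: "coeff (variance_poly q - variance_expansion_poly q) 4 = 0"
    unfolding coeff_diff expansion coeffs
    by (rule cancel') (simp add: N, algebra)
  have "k = 0 \<or> k = 1 \<or> k = 2 \<or> k = 3 \<or> k = 4" if "k < 5" for k :: nat
    using that by presburger
  then show ?thesis using 0 1 2 3 4 by metis
qed

lemma bigo_imp_tendsto_0:
  fixes f g :: "nat \<Rightarrow> real"
  assumes "f \<in> O(g)" "g \<longlonglongrightarrow> 0"
  shows "f \<longlonglongrightarrow> 0"
proof -
  obtain c where "eventually (\<lambda>n. norm (f n) \<le> norm (g n) * c) sequentially"
    using landau_o.bigE[OF assms(1)] by (auto simp: mult.commute)
  with assms(2) show ?thesis by (rule tendsto_0_le)
qed

theorem theorem6:
  fixes q :: real
  assumes "0 < q" and "q < 1 / 2"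
  shows "(\<lambda>n. phase2_variance q n)
           \<longlonglongrightarrow> (1 - q) * (2 + 3 * q - 4 * q ^ 2) / (1 - 2 * q) ^ 4
    \<and> (\<lambda>n. phase2_variance q n -
          ((q - 1) * (4 * q ^ 2 - 3 * q - 2) / (2 * q - 1) ^ 4
           - (q - 1) * (4 * q ^ 2 + 2 * q - 7) / (2 * q - 1) ^ 6 * (1 / real n)
           - (q - 1) * (24 * q ^ 4 - 12 * q ^ 3 - 58 * q ^ 2 + 29 * q + 18)
               / (2 * q - 1) ^ 8 * (1 / real n ^ 2)
           - (q - 1) * (144 * q ^ 6 - 216 * q ^ 5 - 348 * q ^ 4 + 444 * q ^ 3 + 328 * q ^ 2
                 - 312 * q - 41)
               / (2 * q - 1) ^ 10 * (1 / real n ^ 3)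
           - (q - 1) * (864 * q ^ 8 - 2160 * q ^ 7 - 1704 * q ^ 6 + 4956 * q ^ 5 + 4632 * q ^ 4
                 - 9972 * q ^ 3 + 1586 * q ^ 2 + 1711 * q + 88)
               / (2 * q - 1) ^ 12 * (1 / real n ^ 4)))
        \<in> O(\<lambda>n. 1 / real n ^ 5)"
proof -
  define b where "b = (1 - 2 * q)\<^sup>2"
  define H where "H = ratio_poly b"
  define s where "s n = real n * (1 / tail_ratio q n - coeff H 0)" for n
  define s' where "s' n = real n * (s n - coeff H 1)" for n
  define \<alpha> where "\<alpha> = - 1 / (2 * q\<^sup>2 * (1 - 2 * q)\<^sup>2)"
  define \<beta> where "\<beta> = 2 * (1 - q) / (1 - 2 * q) ^ 4 - (1 - q) / (2 * q\<^sup>2 * (1 - 2 * q) ^ 3)"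
  define \<gamma> where "\<gamma> = - 1 / (4 * (1 - 2 * q) ^ 4 * q\<^sup>2)"
  define E where "E n = poly (variance_expansion_poly q) (1 / real n)" for n
  note q = assms
  have b: "0 < b" "b < 1" "1 - b = 4 * q * (1 - q)"
  proof -
    show b: "1 - b = 4 * q * (1 - q)" by (simp add: b_def power2_eq_square algebra_simps)
    have "0 < 4 * q * (1 - q)" using q by simp
    then show "b < 1" using b by linarith
    show "0 < b" using q by (simp add: b_def)
  qed
  have H: "coeff H 0 = b" "coeff H 1 = 2 * (1 - q) * q"
    using b(1) by (simp_all add: H_def ratio_poly_0 ratio_poly_1 b(3) del: One_nat_def)
  have "(\<lambda>n. 1 / tail_ratio q n - poly H (1 / real n)) \<in> O(\<lambda>n. 1 / real n ^ 7)"
    unfolding H_def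
  proof (rule ratio_expansion[where B = "1 / b"])
    fix n :: nat assume n: "n \<ge> 1"
    have "2 * q * (1 - q) * (2 * real n + 1) / (real n + 1) =
        (1 - b) * (2 * real n + 1) / (2 * (real n + 1))"
      unfolding b(3) by (simp add: divide_simps)
    then show "tail_ratio q n =
        1 + (1 - b) * (2 * real n + 1) / (2 * (real n + 1)) * tail_ratio q (Suc n)"
      using tail_ratio_Suc[OF q n] by metis
    show "1 \<le> tail_ratio q n" "tail_ratio q n \<le> 1 / b"
      using tail_ratio_bounds[OF q n] by (auto simp: b_def)
  qed (use b in auto)
  from quadratic_perturbation_bigo[OF this, of \<alpha> \<beta> \<gamma>]
  have "(\<lambda>n. \<alpha> * s' n + \<beta> * s n + \<gamma> * s n ^ 2 - poly (variance_poly q) (1 / real n))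
      \<in> O(\<lambda>n. 1 / real n ^ 5)"
    by (simp add: variance_poly_def Let_def \<alpha>_def \<beta>_def \<gamma>_def s'_def s_def H_def b_def)
  \<comment> \<open>For \<open>n \<ge> 1\<close> this is exact: \<open>coeff H 0\<close> and
    \<open>coeff H 1\<close> are the constants subtracted in
    \<open>phase2_variance_tail_ratio\<close>.\<close>
  moreover have "eventually (\<lambda>n. \<alpha> * s' n + \<beta> * s n + \<gamma> * s n ^ 2 - poly (variance_poly q) (1 / real n)
      = phase2_variance q n - poly (variance_poly q) (1 / real n)) sequentially"
    using eventually_ge_at_top[of 1]
  proof eventually_elim
    case (elim n)
    have "s n = real n * (1 / tail_ratio q n - (1 - 2 * q)\<^sup>2)"
      "s' n = real n * (s n - 2 * (1 - q) * q)"
      by (simp_all only: s_def s'_def H b_def)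
    note V = phase2_variance_tail_ratio[OF q elim, folded this(1), folded this(2)]
    have "\<alpha> * A + \<beta> * B + \<gamma> * C = ((- A - (1 - q) * B / \<delta>) / (q\<^sup>2 * \<delta>\<^sup>2) + 4 * (1 - q) * B / \<delta> ^ 4) / 2
        - C / (4 * \<delta> ^ 4 * q\<^sup>2)" if "\<delta> = 1 - 2 * q" for A B C \<delta> :: real
    proof -
      have "\<delta> \<noteq> 0" "q \<noteq> 0" using that q by auto
      then show ?thesis
        unfolding \<alpha>_def \<beta>_def \<gamma>_def that[symmetric]
        by (simp add: divide_simps) algebra
    qed
    then show ?case unfolding V by simp
  qed
  ultimately have "(\<lambda>n. phase2_variance q n - poly (variance_poly q) (1 / real n)) \<in> O(\<lambda>n. 1 / real n ^ 5)"
    by (rule landau_o.big.in_cong[THEN iffD1, rotated])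
  \<comment> \<open>The two polynomials agree below degree 5, so exchanging them costs
    \<open>O(1 / n ^ 5)\<close>.\<close>
  from sum_in_bigo(1)[OF this poly_inverse_nat_bigo[OF coeff_variance_poly[OF q]]]
  have bigo: "(\<lambda>n. phase2_variance q n - E n) \<in> O(\<lambda>n. 1 / real n ^ 5)"
    by (simp add: E_def)
  have "(\<lambda>n. 1 / real n ^ 5) \<longlonglongrightarrow> 0"
    using tendsto_power[OF lim_1_over_n, of 5] by (simp add: power_divide)
  with bigo have "(\<lambda>n. phase2_variance q n - E n) \<longlonglongrightarrow> 0"
    by (rule bigo_imp_tendsto_0)
  \<comment> \<open>The limit is the constant term of the expansion, rewritten with both signs
    changed.\<close>
  moreover have "E \<longlonglongrightarrow> (1 - q) * (2 + 3 * q - 4 * q ^ 2) / (1 - 2 * q) ^ 4"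
  proof -
    have "(q - 1) * (4 * q\<^sup>2 - 3 * q - 2) = (1 - q) * (2 + 3 * q - 4 * q\<^sup>2)"
      "(2 * q - 1) ^ 4 = (1 - 2 * q) ^ 4" by algebra+
    then have "poly (variance_expansion_poly q) 0 = (1 - q) * (2 + 3 * q - 4 * q ^ 2) / (1 - 2 * q) ^ 4"
      by (simp add: variance_expansion_poly_def)
    then show ?thesis
      using poly_inverse_nat_tendsto[of "variance_expansion_poly q"] by (simp add: E_def[abs_def])
  qed
  ultimately have "(\<lambda>n. phase2_variance q n - E n + E n) \<longlonglongrightarrow>
      0 + (1 - q) * (2 + 3 * q - 4 * q ^ 2) / (1 - 2 * q) ^ 4"
    by (rule tendsto_add)
  then have lim: "(\<lambda>n. phase2_variance q n) \<longlonglongrightarrow> (1 - q) * (2 + 3 * q - 4 * q ^ 2) / (1 - 2 * q) ^ 4"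
    by simp
  have Horner: "poly [:c0, - c1, - c2, - c3, - c4:] (1 / x) =
      c0 - c1 * (1 / x) - c2 * (1 / x ^ 2) - c3 * (1 / x ^ 3) - c4 * (1 / x ^ 4)" for c0 c1 c2 c3 c4 x :: real
    by (simp add: eval_nat_numeral algebra_simps)
  show ?thesis
    using lim bigo unfolding E_def variance_expansion_poly_def Horner by blast
qed

end
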